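(* Let $\{A_e+\bm v_e\}_{e\in\mathcal E}$ be a GLS IFS and let $\bm\alpha=(\alpha_e)_{e\in\mathcal E}\in[0,1]^{\#\mathcal E}$ be a frequency vector with $\alpha_j:=\sum_{k=0}^{B_j-1}\alpha_{(j,k)}>0$ for all $0\le j<J$. Then \[\dim_{\mathrm H}(F_y(\bm\alpha))\le\frac{\sum_{e\in\mathcal E}\alpha_e\log\alpha_e-\sum_{0\le j<J}\alpha_j\log\alpha_j}{\sum_{e\in\mathcal E}\alpha_e\log q_e}\] for all $y\in W(\bm\alpha)$. Furthermore, if $\bm\alpha$ satisfies that for each $0\le j<J$ there are $k,\ell\in\{0,\dots,B_j-1\}$ with $k\ne\ell$, $\alpha_{(j,k)}>0$ and $\alpha_{(j,\ell)}>0$, then \[\dim_{\mathrm H}(F_y(\bm\alpha))\ge\frac{\sum_{e\in\mathcal E}\alpha_e\log\alpha_e-\sum_{0\le j<J}\alpha_j\log\alpha_j}{\sum_{e\in\mathcal E}\alpha_e\log q_e}\] for $\nu_{\bm\alpha}$-a.e. $y\in W(\bm\alpha)$.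
   Context: **GLS IFS.** A GLS IFS is given by: an integer $J\ge2$; a probability vector $(p_j)_{0\le j<J}$ with all $p_j>0$; and for each $0\le j<J$ an integer $B_j\ge2$, a partition $0=r_{(j,0)}<r_{(j,1)}<\cdots<r_{(j,B_j)}=1$ and a vector $(\varepsilon_{(j,k)})_{0\le k<B_j}\in\{0,1\}^{B_j}$. Set $\mathcal E=\{(j,k):0\le j<J,\ 0\le k<B_j\}$, $q_{(j,k)}=r_{(j,k+1)}-r_{(j,k)}$, and \[A_{(j,k)}=\begin{bmatrix}(-1)^{\varepsilon_{(j,k)}}q_{(j,k)}&0\\0&p_j\end{bmatrix},\qquad \bm v_{(j,k)}=\begin{bmatrix}r_{(j,k)}+\varepsilon_{(j,k)}q_{(j,k)}\\ \sum_{i=0}^{j-1}p_i\end{bmatrix}.\] The GLS IFS is the IFS $\{A_e+\bm v_e\}_{e\in\mathcal E}$ on $\mathbb R^2$; its attractor is $[0,1]^2$. The projection $\pi:\mathcal E^{\mathbb N}\to[0,1]^2$ is $\pi(\omega)=\sum_{n\ge1}A_{\omega_1}\cdots A_{\omega_{n-1}}\bm v_{\omega_n}$ (empty product is the identity). **Frequencies and level sets.** For $e\in\mathcal E$, $\omega\in\mathcal E^{\mathbb N}$, $\tau_e(\omega)=\lim_{n\to\infty}\frac1n\#\{1\le i\le n:\omega_i=e\}$ when the limit exists. A frequency vector is $\bm\alpha=(\alpha_e)_{e\in\mathcal E}\in[0,1]^{\#\mathcal E}$ with $\sum_{e\in\mathcal E}\alpha_e=1$. For $y\in[0,1]$, \[F_y(\bm\alpha)=\{x\in[0,1]:\exists\,\omega\in\pi^{-1}\{(x,y)\}\text{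 s.t. }\tau_e(\omega)=\alpha_e\text{ for all }e\in\mathcal E\},\] \[W(\bm\alpha)=\{y\in[0,1]:F_y(\bm\alpha)\ne\emptyset\}.\] **The measure $\nu_{\bm\alpha}$.** $\mu_{\bm\alpha}$ is the $\bm\alpha$-Bernoulli measure on $\mathcal E^{\mathbb N}$, i.e. the cylinder of sequences starting with $e_1\cdots e_n$ has measure $\alpha_{e_1}\cdots\alpha_{e_n}$. Let $f_j(y)=p_jy+\sum_{i=0}^{j-1}p_i$ and $\pi_2:\mathcal E^{\mathbb N}\to[0,1]$, $\pi_2((j_m,k_m)_{m\ge1})=\lim_{m\to\infty}f_{j_1}\circ\cdots\circ f_{j_m}(0)$. Then $\nu_{\bm\alpha}=\mu_{\bm\alpha}\circ\pi_2^{-1}$. Convention: $0\log0=0$. $\dim_{\mathrm H}$ is Hausdorff dimension. *)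

theory Defs
  imports "HOL-Probability.Probability"
begin

section \<open>Hausdorff measure and dimension\<close>

text \<open>
  The value \<open>diam(U)^s\<close>, with the usual conventions that the empty set contributes \<open>0\<close> and
  that \<open>diam(U)^0 = 1\<close> for nonempty \<open>U\<close>; the latter has to be stated separately because
  \<open>0 powr 0 = 0\<close>.
\<close>
definition diam_pow :: "real \<Rightarrow> 'a::metric_space set \<Rightarrow> ennreal" where
  "diam_pow s U =
    (if U = {} then 0 else if s = 0 then 1 else ennreal (diameter U powr s))"

text \<open>
  Covers by sequences of sets; finite covers are obtained by padding with empty sets.
  Boundedness is required explicitly since \<^const>\<open>diameter\<close> is meaningless on unbounded sets.
\<close>
definition hausdorff_premeasure :: "real \<Rightarrow> real \<Rightarrow> 'a::metric_space set \<Rightarrow> ennreal" where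
  "hausdorff_premeasure s \<delta> X =
    Inf {(\<Sum>i. diam_pow s (U i)) | U :: nat \<Rightarrow> 'a set.
           X \<subseteq> (\<Union>i. U i) \<and> (\<forall>i. bounded (U i) \<and> diameter (U i) \<le> \<delta>)}"

definition hausdorff_measure :: "real \<Rightarrow> 'a::metric_space set \<Rightarrow> ennreal" where
  "hausdorff_measure s X = (SUP \<delta>\<in>{0<..}. hausdorff_premeasure s \<delta> X)"

definition hausdorff_dim :: "'a::metric_space set \<Rightarrow> ereal" where
  "hausdorff_dim X = Inf (ereal ` {s. 0 \<le> s \<and> hausdorff_measure s X = 0})"


section \<open>GLS iterated function systems\<close>

text \<open>
  The data \<open>J\<close>, \<open>p j\<close>, \<open>B j\<close>, \<open>r (j, k)\<close>, \<open>\<epsilon> (j, k)\<close>. The functions are total; only their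
  values at indices \<open>j < J\<close>, \<open>k < B j\<close> (\<open>k \<le> B j\<close> for \<open>r\<close>) matter.
\<close>
record gls =
  gls_J :: nat
  gls_p :: "nat \<Rightarrow> real"
  gls_B :: "nat \<Rightarrow> nat"
  gls_r :: "nat \<times> nat \<Rightarrow> real"
  gls_eps :: "nat \<times> nat \<Rightarrow> nat"

definition gls_ifs :: "gls \<Rightarrow> bool" where
  "gls_ifs G \<longleftrightarrow>
     2 \<le> gls_J G \<and>
     (\<forall>j<gls_J G. 0 < gls_p G j) \<and>
     (\<Sum>j<gls_J G. gls_p G j) = 1 \<and>
     (\<forall>j<gls_J G.
        2 \<le> gls_B G j \<and>
        gls_r G (j, 0) = 0 \<and>
        (\<forall>k<gls_B G j. gls_r G (j, k) < gls_r G (j, Suc k)) \<and>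
        gls_r G (j, gls_B G j) = 1 \<and>
        (\<forall>k<gls_B G j. gls_eps G (j, k) \<in> {0, 1}))"

definition alphabet :: "gls \<Rightarrow> (nat \<times> nat) set" where
  "alphabet G = {(j, k). j < gls_J G \<and> k < gls_B G j}"

fun gls_q :: "gls \<Rightarrow> nat \<times> nat \<Rightarrow> real" where
  "gls_q G (j, k) = gls_r G (j, Suc k) - gls_r G (j, k)"

fun gls_A :: "gls \<Rightarrow> nat \<times> nat \<Rightarrow> real^2^2" where
  "gls_A G (j, k) =
     vector [vector [(- 1) ^ gls_eps G (j, k) * gls_q G (j, k), 0],
             vector [0, gls_p G j]]"

fun gls_v :: "gls \<Rightarrow> nat \<times> nat \<Rightarrow> real^2" where
  "gls_v G (j, k) =
     vector [gls_r G (j, k) + real (gls_eps G (j, k)) * gls_q G (j, k),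
             (\<Sum>i<j. gls_p G i)]"

text \<open>Sequences are indexed from \<open>0\<close>: \<open>\<omega> n\<close> is the letter \<open>\<omega>\<^bsub>n+1\<^esub>\<close>.\<close>
definition sequences :: "gls \<Rightarrow> (nat \<Rightarrow> nat \<times> nat) set" where
  "sequences G = {\<omega>. \<forall>n. \<omega> n \<in> alphabet G}"

primrec gls_A_prod :: "gls \<Rightarrow> (nat \<Rightarrow> nat \<times> nat) \<Rightarrow> nat \<Rightarrow> real^2^2" where
  "gls_A_prod G \<omega> 0 = mat 1"
| "gls_A_prod G \<omega> (Suc n) = gls_A_prod G \<omega> n ** gls_A G (\<omega> n)"

definition gls_pi :: "gls \<Rightarrow> (nat \<Rightarrow> nat \<times> nat) \<Rightarrow> real^2" where
  "gls_pi G \<omega> = (\<Sum>n. gls_A_prod G \<omega> n *v gls_v G (\<omega> n))"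


section \<open>Frequencies and level sets\<close>

text \<open>\<open>has_frequency \<omega> e a\<close>: the limit \<open>\<tau>\<^sub>e(\<omega>)\<close> exists and equals \<open>a\<close>.\<close>
definition has_frequency :: "(nat \<Rightarrow> 'e) \<Rightarrow> 'e \<Rightarrow> real \<Rightarrow> bool" where
  "has_frequency \<omega> e a \<longleftrightarrow>
     (\<lambda>n. real (card {i. i < n \<and> \<omega> i = e}) / real n) \<longlonglongrightarrow> a"

definition frequency_vector :: "gls \<Rightarrow> (nat \<times> nat \<Rightarrow> real) \<Rightarrow> bool" where
  "frequency_vector G \<alpha> \<longleftrightarrow>
     (\<forall>e\<in>alphabet G. \<alpha> e \<in> {0..1}) \<and> (\<Sum>e\<in>alphabet G. \<alpha> e) = 1"

definition row_frequency :: "gls \<Rightarrow> (nat \<times> nat \<Rightarrow> real) \<Rightarrow> nat \<Rightarrow> real" where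
  "row_frequency G \<alpha> j = (\<Sum>k<gls_B G j. \<alpha> (j, k))"

definition level_set :: "gls \<Rightarrow> (nat \<times> nat \<Rightarrow> real) \<Rightarrow> real \<Rightarrow> real set" where
  "level_set G \<alpha> y =
     {x \<in> {0..1}. \<exists>\<omega>\<in>sequences G.
        gls_pi G \<omega> = vector [x, y] \<and> (\<forall>e\<in>alphabet G. has_frequency \<omega> e (\<alpha> e))}"

definition level_heights :: "gls \<Rightarrow> (nat \<times> nat \<Rightarrow> real) \<Rightarrow> real set" where
  "level_heights G \<alpha> = {y \<in> {0..1}. level_set G \<alpha> y \<noteq> {}}"


section \<open>The projected Bernoulli measure\<close>

definition bernoulli_measure :: "gls \<Rightarrow> (nat \<times> nat \<Rightarrow> real) \<Rightarrow> (nat \<Rightarrow> nat \<times> nat) measure" where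
  "bernoulli_measure G \<alpha> =
     (\<Pi>\<^sub>M n\<in>(UNIV :: nat set). point_measure (alphabet G) (\<lambda>e. ennreal (\<alpha> e)))"

definition row_map :: "gls \<Rightarrow> nat \<Rightarrow> real \<Rightarrow> real" where
  "row_map G j y = gls_p G j * y + (\<Sum>i<j. gls_p G i)"

primrec row_comp :: "gls \<Rightarrow> (nat \<Rightarrow> nat \<times> nat) \<Rightarrow> nat \<Rightarrow> real \<Rightarrow> real" where
  "row_comp G \<omega> 0 = id"
| "row_comp G \<omega> (Suc m) = row_comp G \<omega> m \<circ> row_map G (fst (\<omega> m))"

definition gls_pi2 :: "gls \<Rightarrow> (nat \<Rightarrow> nat \<times> nat) \<Rightarrow> real" where
  "gls_pi2 G \<omega> = lim (\<lambda>m. row_comp G \<omega> m 0)"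

text \<open>Regarded as a Borel measure on the whole line; it is supported in \<open>[0, 1]\<close>.\<close>
definition gls_nu :: "gls \<Rightarrow> (nat \<times> nat \<Rightarrow> real) \<Rightarrow> real measure" where
  "gls_nu G \<alpha> = distr (bernoulli_measure G \<alpha>) borel (gls_pi2 G)"

end

theory Submission
  imports Defs "HOL-Library.Nat_Bijection"
begin

text \<open>
  Both bounds come from comparing, on a single fibre, the lengths of the cells of the coding with a
  product weight on words.

  A height \<open>y\<close> in \<open>W(\<alpha>)\<close> is coded by a row sequence \<open>J\<close> with \<open>\<tau>\<^sub>j(J) = \<alpha>\<^sub>j\<close> for every row. This
  sequence is unique (\<open>row_sequence_unique\<close>): a height with two codings has one that ends in rows \<open>0\<close>
  only, so that row \<open>1\<close> has frequency \<open>0 \<noteq> \<alpha>\<^sub>1\<close>. Once \<open>J\<close> is fixed, a point of the fibre is described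
  by a sequence of digits \<open>k\<^sub>i < B\<^bsub>J i\<^esub>\<close>; its first \<open>n\<close> digits determine a cell, an interval whose
  length \<open>\<Prod>i<n. q (J i, k\<^sub>i)\<close> is called \<open>len\<close>. If the sequence of letters \<open>(J i, k\<^sub>i)\<close> has frequencies
  \<open>\<alpha>\<close>, then for each function \<open>g\<close> of letters the averages of \<open>g\<close> along it converge to
  \<open>\<Sum>e. \<alpha> e * g e\<close> (\<open>frequency_average\<close>). With the conditional probabilities
  \<open>b (j, k) = \<alpha> (j, k) / \<alpha>\<^sub>j\<close> (called \<open>cond\<close>) the numerator of the claimed dimension is \<open>\<Sum>e. \<alpha> e * ln (b e)\<close>
  (\<open>entropy_cond\<close>). So a word of length \<open>n\<close> typical for \<open>\<alpha>\<close> has \<open>b\<close>-weight about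
  \<open>exp (n * entropy)\<close> and a cell of length about \<open>exp (n * lyapunov)\<close>, and the claimed dimension is
  the ratio of these two exponents.

  Upper bound. Let \<open>s\<close> exceed the ratio. After a small perturbation that makes \<open>b\<close> positive, every
  point of the level set lies, for all large \<open>n\<close>, in a cell with
  \<open>len powr s \<le> exp (- c * n) * weight\<close>. The weights of all words of one length add up to \<open>1\<close>, so these
  cells cover the level set with an arbitrarily small sum of \<open>s\<close>-th powers of diameters
  (\<open>hausdorff_measure_0_of_weights\<close>).

  Lower bound. Choose the digits of the fibre over \<open>J\<close> independently, the \<open>i\<close>-th with law
  \<open>b (J i, \<cdot>)\<close>. The strong law for independent, not identically distributed bounded variables and the
  known frequencies of \<open>J\<close> show that almost every choice has letter frequencies \<open>\<alpha>\<close>, hence codes a point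
  of the level set (\<open>AE_frequencies\<close>). If \<open>s\<close> is below the ratio, then eventually
  \<open>weight \<le> len powr s\<close> almost surely. A set of diameter at most \<open>d\<close> meets only boundedly many cells of
  length comparable to \<open>d\<close> (\<open>cylinder_cover\<close>), so a cover with a small sum of \<open>s\<close>-th powers of diameters
  would catch only a small part of the probability (\<open>mass_distribution\<close>). The probability lives on the
  fibre over one given \<open>J\<close>, so this bounds the dimension at each single height in \<open>W(\<alpha>)\<close>, and the
  statement for \<open>\<nu>\<^sub>\<alpha>\<close>-almost every height follows.
\<close>
section \<open>Null sets of the Hausdorff measure\<close>

lemma hausdorff_measure_eq_0_iff:
  "hausdorff_measure s X = 0 \<longleftrightarrow>
    (\<forall>\<delta>>0. \<forall>\<epsilon>>0. \<exists>U :: nat \<Rightarrow> 'a::metric_space set. X \<subseteq> (\<Union>i. U i) \<and>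
       (\<forall>i. bounded (U i) \<and> diameter (U i) \<le> \<delta>) \<and> (\<Sum>i. diam_pow s (U i)) < ennreal \<epsilon>)"
    (is "?L \<longleftrightarrow> ?R")
proof -
  have inf_iff: "hausdorff_premeasure s \<delta> X = 0 \<longleftrightarrow>
      (\<forall>\<epsilon>>0. \<exists>U. X \<subseteq> (\<Union>i. U i) \<and>
       (\<forall>i. bounded (U i) \<and> diameter (U i) \<le> \<delta>) \<and> (\<Sum>i. diam_pow s (U i)) < ennreal \<epsilon>)"
    (is "?P = 0 \<longleftrightarrow> ?Q") for \<delta>
  proof
    assume "?P = 0"
    show ?Q
    proof (intro allI impI)
      fix \<epsilon> :: real assume "\<epsilon> > 0"
      then have "?P < ennreal \<epsilon>" using \<open>?P = 0\<close> by simp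
      then show "\<exists>U. X \<subseteq> (\<Union>i. U i) \<and>
         (\<forall>i. bounded (U i) \<and> diameter (U i) \<le> \<delta>) \<and> (\<Sum>i. diam_pow s (U i)) < ennreal \<epsilon>"
        unfolding hausdorff_premeasure_def Inf_less_iff by auto
    qed
  next
    assume Q: ?Q
    have "?P \<le> 0"
    proof (rule ennreal_le_epsilon)
      fix \<epsilon> :: real assume "\<epsilon> > 0"
      then obtain U where U: "X \<subseteq> (\<Union>i. U i)" "\<forall>i. bounded (U i) \<and> diameter (U i) \<le> \<delta>"
        "(\<Sum>i. diam_pow s (U i)) < ennreal \<epsilon>" using Q by blast
      have "?P \<le> (\<Sum>i. diam_pow s (U i))"
        unfolding hausdorff_premeasure_def using U by (intro Inf_lower) auto
      then show "?P \<le> 0 + ennreal \<epsilon>" using U(3) by simp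
    qed
    then show "?P = 0" by simp
  qed
  have "?L \<longleftrightarrow> (\<forall>\<delta>\<in>{0<..}. hausdorff_premeasure s \<delta> X = 0)"
    unfolding hausdorff_measure_def
    by (metis (no_types, lifting) SUP_least SUP_upper bot_ennreal le_zero_eq)
  then show ?thesis unfolding inf_iff Ball_def greaterThan_iff .
qed

section \<open>Letter frequencies\<close>

lemma has_frequency_of_bool:
  "has_frequency \<omega> e x \<longleftrightarrow> (\<lambda>n. (\<Sum>i<n. of_bool (\<omega> i = e)) / real n) \<longlonglongrightarrow> x"
proof -
  have "real (card {i. i < n \<and> \<omega> i = e}) = (\<Sum>i<n. of_bool (\<omega> i = e))" for n
    by (simp add: of_bool_def sum.If_cases Int_def)
  then show ?thesis by (simp add: has_frequency_def)
qed

text \<open>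
  Only the letter counts enter an ergodic average of a function on a finite alphabet.
\<close>
lemma frequency_average:
  fixes g :: "'e \<Rightarrow> real"
  assumes "finite E" "\<And>i. \<omega> i \<in> E" "\<And>e. e \<in> E \<Longrightarrow> has_frequency \<omega> e (\<alpha> e)"
  shows "(\<lambda>n. (\<Sum>i<n. g (\<omega> i)) / real n) \<longlonglongrightarrow> (\<Sum>e\<in>E. \<alpha> e * g e)"
proof -
  have eq: "(\<Sum>i<n. g (\<omega> i)) / real n = (\<Sum>e\<in>E. ((\<Sum>i<n. of_bool (\<omega> i = e)) / real n) * g e)" for n
  proof -
    have "g (\<omega> i) = (\<Sum>e\<in>E. of_bool (\<omega> i = e) * g e)" for i
      using assms(1) assms(2)[of i] by (simp add: of_bool_def if_distrib[of "\<lambda>x. x * _"] cong: if_cong)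
    then have "(\<Sum>i<n. g (\<omega> i)) = (\<Sum>i<n. \<Sum>e\<in>E. of_bool (\<omega> i = e) * g e)" by simp
    also have "\<dots> = (\<Sum>e\<in>E. (\<Sum>i<n. of_bool (\<omega> i = e)) * g e)"
      by (subst sum.swap) (simp add: sum_distrib_right)
    finally show ?thesis by (simp add: sum_divide_distrib)
  qed
  show ?thesis
    unfolding eq using assms(3) by (intro tendsto_sum tendsto_mult tendsto_const) (simp add: has_frequency_of_bool)
qed

section \<open>Separated families of reals\<close>

text \<open>
  The map \<open>i \<mapsto> \<lfloor>f i / h\<rfloor>\<close> is injective because the values are \<open>h\<close>-separated, and it takes values in
  an integer interval with about \<open>2 R / h\<close> elements.
\<close>
lemma card_separated:
  fixes f :: "'i \<Rightarrow> real"
  assumes "0 < h" and bd: "\<And>i. i \<in> W \<Longrightarrow> \<bar>f i - c\<bar> \<le> R"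
    and sep: "\<And>i j. i \<in> W \<Longrightarrow> j \<in> W \<Longrightarrow> i \<noteq> j \<Longrightarrow> h \<le> \<bar>f i - f j\<bar>"
  shows "finite W" "W \<noteq> {} \<Longrightarrow> real (card W) \<le> 2 * R / h + 2"
proof -
  let ?g = "\<lambda>i. \<lfloor>f i / h\<rfloor>" and ?I = "{\<lfloor>(c - R) / h\<rfloor>..\<lfloor>(c + R) / h\<rfloor>}"
  have inj: "inj_on ?g W"
  proof (rule inj_onI, rule ccontr)
    fix i j assume ij: "i \<in> W" "j \<in> W" "?g i = ?g j" "i \<noteq> j"
    then have "\<bar>f i / h - f j / h\<bar> < 1" by linarith
    then have "\<bar>f i - f j\<bar> < h"
      using \<open>0 < h\<close> by (simp add: diff_divide_distrib[symmetric] abs_divide)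
    with sep ij show False by fastforce
  qed
  have sub: "?g ` W \<subseteq> ?I"
    using bd \<open>0 < h\<close> by (force intro!: floor_mono divide_right_mono simp: abs_le_iff)
  show fin: "finite W"
    using finite_subset[OF sub] inj finite_image_iff by blast
  assume "W \<noteq> {}"
  then obtain i where "i \<in> W" by blast
  then have "\<bar>f i - c\<bar> \<le> R" using bd by blast
  then have "(c - R) / h \<le> (c + R) / h" using \<open>0 < h\<close> by (intro divide_right_mono) auto
  then have le: "\<lfloor>(c - R) / h\<rfloor> \<le> \<lfloor>(c + R) / h\<rfloor>" by (rule floor_mono)
  have "card W \<le> card ?I"
    using card_inj_on_le[OF inj sub] by simp
  also have "real (card ?I) = real_of_int \<lfloor>(c + R) / h\<rfloor> - real_of_int \<lfloor>(c - R) / h\<rfloor> + 1"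
    using le by (simp add: of_nat_nat)
  also have "\<dots> \<le> (c + R) / h - (c - R) / h + 2" by linarith
  also have "\<dots> = 2 * R / h + 2" by (simp add: diff_divide_distrib[symmetric])
  finally show "real (card W) \<le> 2 * R / h + 2" by simp
qed

section \<open>A strong law for bounded independent variables\<close>

text \<open>
  Hoeffding's inequality bounds the probability of a deviation \<open>\<epsilon> n\<close> by a geometric sequence, so
  the Borel-Cantelli lemma applies; the laws may vary with \<open>i\<close>.
\<close>
lemma (in prob_space) strong_law_bounded:
  fixes X :: "nat \<Rightarrow> 'a \<Rightarrow> real"
  assumes indep: "indep_vars (\<lambda>_. borel) X UNIV"
    and bounds: "\<And>i \<omega>. \<omega> \<in> space M \<Longrightarrow> X i \<omega> \<in> {0..1}"
  shows "AE \<omega> in M. (\<lambda>n. ((\<Sum>i<n. X i \<omega>) - (\<Sum>i<n. expectation (X i))) / real n) \<longlonglongrightarrow> 0"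
proof -
  have [measurable]: "random_variable borel (X i)" for i
    using indep by (auto simp: indep_vars_def)
  let ?D = "\<lambda>n \<omega>. (\<Sum>i<n. X i \<omega>) - (\<Sum>i<n. expectation (X i))"
  define bad where "bad \<epsilon> n = {\<omega>\<in>space M. \<epsilon> * real n \<le> \<bar>?D n \<omega>\<bar>}" for \<epsilon> n
  have bad_sets: "bad \<epsilon> n \<in> events" for \<epsilon> n
    unfolding bad_def by measurable
  have prob_bad: "prob (bad \<epsilon> n) \<le> 2 * exp (- 2 * \<epsilon>\<^sup>2) ^ n" if "0 < \<epsilon>" for \<epsilon> n
  proof (cases "n = 0")
    case True
    have "prob (bad \<epsilon> n) \<le> 1" by (rule prob_le_1)
    then have "prob (bad \<epsilon> n) \<le> 2" by linarith
    then show ?thesis using True by simp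
  next
    case False
    interpret Hoeffding_ineq M "{..<n}" X "\<lambda>_. 0" "\<lambda>_. 1" "\<Sum>i<n. expectation (X i)"
      by unfold_locales (use indep_vars_subset[OF indep] bounds in auto)
    have "prob (bad \<epsilon> n) \<le> 2 * exp (- 2 * (\<epsilon> * real n)\<^sup>2 / real n)"
      using Hoeffding_ineq_abs_ge[of "\<epsilon> * real n"] that False by (simp add: bad_def)
    also have "- 2 * (\<epsilon> * real n)\<^sup>2 / real n = real n * (- 2 * \<epsilon>\<^sup>2)"
      using False by (simp add: power2_eq_square)
    finally show ?thesis by (simp only: exp_of_nat_mult)
  qed
  have "AE \<omega> in M. \<forall>\<^sub>F n in sequentially. \<omega> \<in> space M - bad \<epsilon> n" if "0 < \<epsilon>" for \<epsilon>
  proof (rule borel_cantelli_AE1)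
    have "exp (- 2 * \<epsilon>\<^sup>2) < 1" using that by simp
    then have "summable (\<lambda>n. 2 * exp (- 2 * \<epsilon>\<^sup>2) ^ n)"
      by (intro summable_mult summable_geometric) auto
    then show "summable (\<lambda>n. prob (bad \<epsilon> n))"
      by (rule summable_comparison_test') (use prob_bad[OF that] in auto)
  qed (use bad_sets in \<open>auto simp: emeasure_eq_measure\<close>)
  then have "AE \<omega> in M. \<forall>m. \<forall>\<^sub>F n in sequentially. \<omega> \<in> space M - bad (1 / real (Suc m)) n"
    unfolding AE_all_countable by simp
  then show ?thesis
  proof (rule AE_mp, intro AE_I2 impI)
    fix \<omega> assume \<omega>: "\<omega> \<in> space M" "\<forall>m. \<forall>\<^sub>F n in sequentially. \<omega> \<in> space M - bad (1 / real (Suc m)) n"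
    show "(\<lambda>n. ?D n \<omega> / real n) \<longlonglongrightarrow> 0"
    proof (rule tendstoI)
      fix \<epsilon> :: real assume "0 < \<epsilon>"
      then obtain m where m: "1 / real (Suc m) < \<epsilon>" using nat_approx_posE by metis
      have "\<forall>\<^sub>F n in sequentially. \<omega> \<in> space M - bad (1 / real (Suc m)) n" using \<omega> by blast
      then show "\<forall>\<^sub>F n in sequentially. dist (?D n \<omega> / real n) 0 < \<epsilon>"
        using eventually_gt_at_top[of 0]
      proof eventually_elim
        case (elim n)
        then have "\<bar>?D n \<omega>\<bar> < 1 / real (Suc m) * real n" by (auto simp: bad_def)
        then have "\<bar>?D n \<omega> / real n\<bar> < 1 / real (Suc m)"
          using \<open>0 < n\<close> by (simp add: abs_divide pos_divide_less_eq)
        then show ?case using m by simp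
      qed
    qed
  qed
qed

lemma indep_vars_coordinates:
  "prob_space.indep_vars (PiM UNIV (\<lambda>i :: nat. measure_pmf (P i))) (\<lambda>i. count_space UNIV)
     (\<lambda>i \<omega>. \<omega> i) UNIV"
proof -
  interpret product_prob_space "\<lambda>i. measure_pmf (P i)" UNIV
    by unfold_locales
  let ?M = "PiM UNIV (\<lambda>i. measure_pmf (P i))"
  have comp: "distr ?M (count_space UNIV) (\<lambda>\<omega>. \<omega> i) = measure_pmf (P i)" for i
  proof -
    have "distr ?M (count_space UNIV) (\<lambda>\<omega>. \<omega> i) = distr ?M (measure_pmf (P i)) (\<lambda>\<omega>. \<omega> i)"
      by (intro distr_cong) auto
    then show ?thesis using PiM_component[of i] by simp
  qed
  have sets_eq: "sets (PiM UNIV (\<lambda>i. count_space UNIV)) = sets ?M"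
    by (intro sets_PiM_cong) auto
  show ?thesis
  proof (subst P.indep_vars_iff_distr_eq_PiM)
    show "distr ?M (PiM UNIV (\<lambda>i. count_space UNIV)) (\<lambda>x. \<lambda>i\<in>UNIV. x i) =
        PiM UNIV (\<lambda>i. distr ?M (count_space UNIV) (\<lambda>\<omega>. \<omega> i))"
      unfolding comp using distr_id2[OF sets_eq] by (simp add: restrict_UNIV)
  qed auto
qed

section \<open>Affine codings of points of the unit interval\<close>

text \<open>
  With the maps \<open>T\<^sub>i t = v i + a i * t\<close>, this is the composition \<open>T\<^sub>0 \<circ> \<dots> \<circ> T\<^bsub>n-1\<^esub>\<close> at \<open>t\<close>, expanded so that
  its partial sums are visible; \<open>affine_point\<close> below is the limit of these compositions. Each coordinate
  of the coding map of the IFS is such a limit.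
\<close>
definition affine_iter :: "(nat \<Rightarrow> real) \<Rightarrow> (nat \<Rightarrow> real) \<Rightarrow> nat \<Rightarrow> real \<Rightarrow> real" where
  "affine_iter a v n t = (\<Sum>i<n. (\<Prod>k<i. a k) * v i) + (\<Prod>k<n. a k) * t"

definition affine_point :: "(nat \<Rightarrow> real) \<Rightarrow> (nat \<Rightarrow> real) \<Rightarrow> real" where
  "affine_point a v = (\<Sum>n. (\<Prod>k<n. a k) * v n)"

lemma affine_iter_0 [simp]: "affine_iter a v 0 t = t"
  by (simp add: affine_iter_def)

lemma affine_iter_Suc: "affine_iter a v (Suc n) t = affine_iter a v n (v n + a n * t)"
  by (simp add: affine_iter_def algebra_simps)

lemma affine_iter_cong:
  assumes "\<And>i. i < n \<Longrightarrow> a i = a' i" "\<And>i. i < n \<Longrightarrow> v i = v' i"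
  shows "affine_iter a v n t = affine_iter a' v' n t"
  using assms by (induction n arbitrary: t) (auto simp: affine_iter_Suc)

lemma affine_iter_diff: "affine_iter a v n t - affine_iter a v n u = (\<Prod>k<n. a k) * (t - u)"
  by (simp add: affine_iter_def algebra_simps)

locale affine_code =
  fixes a v :: "nat \<Rightarrow> real" and \<rho> :: real
  assumes contraction: "\<And>i. \<bar>a i\<bar> \<le> \<rho>" "\<rho> < 1"
    and maps_unit: "\<And>i t. t \<in> {0..1} \<Longrightarrow> v i + a i * t \<in> {0..1}"
begin

lemma rho_nonneg: "0 \<le> \<rho>"
  using contraction(1)[of 0] by linarith

lemma abs_prod_le: "\<bar>\<Prod>k<n. a k\<bar> \<le> \<rho> ^ n"
proof -
  have "(\<Prod>k<n. \<bar>a k\<bar>) \<le> (\<Prod>k<n. \<rho>)"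
    by (intro prod_mono) (auto simp: contraction)
  then show ?thesis by (simp add: abs_prod)
qed

lemma summable_code: "summable (\<lambda>n. (\<Prod>k<n. a k) * v n)"
proof (rule summable_comparison_test')
  show "summable (\<lambda>n. \<rho> ^ n)"
    using contraction rho_nonneg by (intro summable_geometric) auto
  fix n :: nat
  have "\<bar>v n\<bar> \<le> 1" using maps_unit[of 0 n] by auto
  then show "norm ((\<Prod>k<n. a k) * v n) \<le> \<rho> ^ n"
    using mult_mono[OF abs_prod_le[of n], of "\<bar>v n\<bar>" 1] rho_nonneg by (simp add: abs_mult)
qed

lemma affine_iter_nested:
  assumes "m \<le> n" "t \<in> {0..1}"
  shows "\<exists>u\<in>{0..1}. affine_iter a v n t = affine_iter a v m u"
  using assms
proof (induction n arbitrary: t rule: dec_induct)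
  case (step n)
  then show ?case
    using maps_unit[of t n] by (auto simp only: affine_iter_Suc)
qed auto

lemma shift: "affine_code (\<lambda>i. a (i + n)) (\<lambda>i. v (i + n)) \<rho>"
  by unfold_locales (use contraction maps_unit in \<open>simp_all del: atLeastAtMost_iff\<close>)

lemma affine_point_shift:
  "affine_point a v = affine_iter a v n (affine_point (\<lambda>i. a (i + n)) (\<lambda>i. v (i + n)))"
proof -
  have prod_eq: "(\<Prod>k<i + n. a k) = (\<Prod>k<n. a k) * (\<Prod>k<i. a (k + n))" for i
    by (induction i) (auto simp: algebra_simps)
  have "affine_point a v = (\<Sum>i. (\<Prod>k<i + n. a k) * v (i + n)) + (\<Sum>i<n. (\<Prod>k<i. a k) * v i)"
    unfolding affine_point_def by (rule suminf_split_initial_segment[OF summable_code])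
  also have "(\<Sum>i. (\<Prod>k<i + n. a k) * v (i + n)) =
      (\<Prod>k<n. a k) * affine_point (\<lambda>i. a (i + n)) (\<lambda>i. v (i + n))"
    unfolding affine_point_def prod_eq mult.assoc
    by (rule suminf_mult[OF affine_code.summable_code[OF shift]])
  finally show ?thesis by (simp add: affine_iter_def)
qed

lemma affine_point_unit: "affine_point a v \<in> {0..1}"
proof -
  have "(\<lambda>n. \<Sum>i<n. (\<Prod>k<i. a k) * v i) \<longlonglongrightarrow> affine_point a v"
    unfolding affine_point_def using summable_LIMSEQ[OF summable_code] by simp
  moreover have "(\<Sum>i<n. (\<Prod>k<i. a k) * v i) \<in> {0..1}" for n
    using affine_iter_nested[of 0 n 0] by (auto simp: affine_iter_def)
  ultimately show ?thesis
    by (rule closed_sequentially[OF closed_atLeastAtMost, rotated])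
qed

lemma affine_point_cylinder: "\<exists>u\<in>{0..1}. affine_point a v = affine_iter a v n u"
  using affine_point_shift[of n] affine_code.affine_point_unit[OF shift[of n]] by blast

end

section \<open>The coordinates of the coding map of a GLS IFS\<close>

definition hor_a :: "gls \<Rightarrow> nat \<times> nat \<Rightarrow> real" where
  "hor_a G e = (- 1) ^ gls_eps G e * gls_q G e"

definition hor_v :: "gls \<Rightarrow> nat \<times> nat \<Rightarrow> real" where
  "hor_v G e = gls_r G e + real (gls_eps G e) * gls_q G e"

definition row_left :: "gls \<Rightarrow> nat \<Rightarrow> real" where
  "row_left G j = (\<Sum>i<j. gls_p G i)"

locale gls_system =
  fixes G :: gls
  assumes gls: "gls_ifs G"
begin

lemma two_rows: "2 \<le> gls_J G"
  and p_pos: "j < gls_J G \<Longrightarrow> 0 < gls_p G j"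
  and p_sum: "(\<Sum>j<gls_J G. gls_p G j) = 1"
  and two_digits: "j < gls_J G \<Longrightarrow> 2 \<le> gls_B G j"
  and r_0: "j < gls_J G \<Longrightarrow> gls_r G (j, 0) = 0"
  and r_less: "j < gls_J G \<Longrightarrow> k < gls_B G j \<Longrightarrow> gls_r G (j, k) < gls_r G (j, Suc k)"
  and r_1: "j < gls_J G \<Longrightarrow> gls_r G (j, gls_B G j) = 1"
  and eps: "j < gls_J G \<Longrightarrow> k < gls_B G j \<Longrightarrow> gls_eps G (j, k) = 0 \<or> gls_eps G (j, k) = 1"
  using gls unfolding gls_ifs_def by auto

lemma in_alphabet [simp]: "(j, k) \<in> alphabet G \<longleftrightarrow> j < gls_J G \<and> k < gls_B G j"
  by (simp add: alphabet_def)

lemma alphabet_Sigma: "alphabet G = Sigma {..<gls_J G} (\<lambda>j. {..<gls_B G j})"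
  by (auto simp: alphabet_def)

lemma finite_alphabet: "finite (alphabet G)"
  by (simp add: alphabet_Sigma)

lemma sum_alphabet: "(\<Sum>e\<in>alphabet G. f e) = (\<Sum>j<gls_J G. \<Sum>k<gls_B G j. f (j, k))"
  by (simp add: alphabet_Sigma sum.Sigma)

lemma r_mono:
  assumes "j < gls_J G" "k \<le> l" "l \<le> gls_B G j"
  shows "gls_r G (j, k) \<le> gls_r G (j, l)"
  using assms(2,3)
proof (induction l rule: dec_induct)
  case (step l)
  then show ?case using r_less[OF assms(1), of l] by simp
qed simp

lemma r_bounds:
  assumes "j < gls_J G" "k \<le> gls_B G j"
  shows "0 \<le> gls_r G (j, k)" "gls_r G (j, k) \<le> 1"
  using r_mono[of j 0 k] r_mono[of j k "gls_B G j"] assms r_0 r_1 by auto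

lemma q_pos: "e \<in> alphabet G \<Longrightarrow> 0 < gls_q G e"
  using r_less by (cases e) auto

lemma q_less_1: 
  assumes "e \<in> alphabet G"
  shows "gls_q G e < 1"
proof -
  obtain j k where e: "e = (j, k)" "j < gls_J G" "k < gls_B G j"
    using assms by (cases e) auto
  show ?thesis
  proof (cases "k = 0")
    case True
    have "gls_r G (j, 1) < gls_r G (j, 2)"
      using r_less[of j 1] two_digits[of j] e by (simp add: numeral_2_eq_2)
    moreover have "gls_r G (j, 2) \<le> 1" using r_bounds[of j 2] two_digits[of j] e by simp
    ultimately show ?thesis using e True r_0[of j] by simp
  next
    case False
    then have "0 < gls_r G (j, k)"
      using r_less[of j 0] r_mono[of j 1 k] r_0[of j] e by simp
    moreover have "gls_r G (j, Suc k) \<le> 1" using r_bounds[of j "Suc k"] e by simp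
    ultimately show ?thesis using e by simp
  qed
qed

lemma abs_hor_a: "e \<in> alphabet G \<Longrightarrow> \<bar>hor_a G e\<bar> = gls_q G e"
  using q_pos[of e] by (simp add: hor_a_def abs_mult power_abs)

lemma hor_map_range:
  assumes "j < gls_J G" "k < gls_B G j" "t \<in> {0..1}"
  shows "hor_v G (j, k) + hor_a G (j, k) * t \<in> {gls_r G (j, k)..gls_r G (j, Suc k)}"
proof -
  let ?q = "gls_q G (j, k)"
  have q: "0 < ?q" "gls_r G (j, Suc k) = gls_r G (j, k) + ?q"
    using q_pos[of "(j, k)"] assms by auto
  have "0 \<le> ?q * t" "?q * t \<le> ?q" using q(1) assms(3) by (auto simp: mult_left_le)
  then show ?thesis
    using eps[OF assms(1,2)] q by (auto simp: hor_v_def hor_a_def simp del: gls_q.simps)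
qed

lemma hor_map_unit:
  assumes "e \<in> alphabet G" "t \<in> {0..1}"
  shows "hor_v G e + hor_a G e * t \<in> {0..1}"
proof -
  obtain j k where e: "e = (j, k)" "j < gls_J G" "k < gls_B G j" using assms by (cases e) auto
  then show ?thesis
    using hor_map_range[OF e(2,3) assms(2)] r_bounds[of j k] r_bounds[of j "Suc k"] by auto
qed

lemma row_left_Suc: "row_left G (Suc j) = row_left G j + gls_p G j"
  by (simp add: row_left_def)

lemma row_left_mono: "i \<le> j \<Longrightarrow> j \<le> gls_J G \<Longrightarrow> row_left G i \<le> row_left G j"
  unfolding row_left_def using p_pos by (intro sum_mono2) (auto intro: less_imp_le)

lemma row_left_pos: "0 < j \<Longrightarrow> j \<le> gls_J G \<Longrightarrow> 0 < row_left G j"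
  using row_left_mono[of 1 j] p_pos[of 0] by (simp add: row_left_def)

lemma row_left_1: "row_left G (gls_J G) = 1"
  by (simp add: row_left_def p_sum)

lemma row_map_unit:
  assumes "j < gls_J G" "t \<in> {0..1}"
  shows "row_left G j + gls_p G j * t \<in> {0..1}"
proof -
  have "0 \<le> row_left G j" using row_left_mono[of 0 j] assms by (simp add: row_left_def)
  moreover have "row_left G j + gls_p G j \<le> 1"
    using row_left_mono[of "Suc j" "gls_J G"] assms row_left_1 row_left_Suc by simp
  moreover have "0 \<le> gls_p G j * t" "gls_p G j * t \<le> gls_p G j"
    using p_pos[OF assms(1)] assms(2) by (auto simp: mult_left_le)
  ultimately show ?thesis by auto
qed

lemma p_less_1:
  assumes "j < gls_J G" shows "gls_p G j < 1"
proof -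
  define i where "i = (if j = 0 then 1 else 0 :: nat)"
  have i: "i < gls_J G" "i \<noteq> j" using two_rows by (auto simp: i_def)
  have "(\<Sum>k\<in>{i, j}. gls_p G k) \<le> (\<Sum>k<gls_J G. gls_p G k)"
    using i assms p_pos by (intro sum_mono2) (auto intro: less_imp_le)
  then show ?thesis using i p_pos[OF i(1)] p_sum by simp
qed

text \<open>
  The alphabet is finite, so one ratio serves for both coordinates.
\<close>
lemma contraction_ratio:
  obtains \<rho> where "\<rho> < 1" "\<And>e. e \<in> alphabet G \<Longrightarrow> gls_q G e \<le> \<rho>" "\<And>j. j < gls_J G \<Longrightarrow> gls_p G j \<le> \<rho>"
proof -
  let ?S = "gls_q G ` alphabet G \<union> gls_p G ` {..<gls_J G}"
  have fin: "finite ?S" using finite_alphabet by simp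
  have ne: "?S \<noteq> {}" using two_rows by (auto simp: lessThan_empty_iff)
  show ?thesis
  proof (rule that[of "Max ?S"])
    show "Max ?S < 1" using fin ne q_less_1 p_less_1 by (subst Max_less_iff) auto
  qed (use fin in \<open>auto intro!: Max_ge\<close>)
qed

lemma hor_code:
  assumes "\<And>e. e \<in> alphabet G \<Longrightarrow> gls_q G e \<le> \<rho>" "\<rho> < 1" "\<And>i. \<omega> i \<in> alphabet G"
  shows "affine_code (\<lambda>i. hor_a G (\<omega> i)) (\<lambda>i. hor_v G (\<omega> i)) \<rho>"
  using assms by unfold_locales (auto simp: abs_hor_a hor_map_unit simp del: atLeastAtMost_iff)

lemma row_code:
  assumes "\<And>j. j < gls_J G \<Longrightarrow> gls_p G j \<le> \<rho>" "\<rho> < 1" "\<And>i. J i < gls_J G"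
  shows "affine_code (\<lambda>i. gls_p G (J i)) (\<lambda>i. row_left G (J i)) \<rho>"
  using assms p_pos by unfold_locales (auto simp: row_map_unit abs_of_pos simp del: atLeastAtMost_iff)

text \<open>The matrices are diagonal, so the coding map splits into two scalar codings.\<close>
lemma gls_pi_eq:
  assumes "\<omega> \<in> sequences G"
  shows "gls_pi G \<omega> = vector [affine_point (\<lambda>i. hor_a G (\<omega> i)) (\<lambda>i. hor_v G (\<omega> i)),
                              affine_point (\<lambda>i. gls_p G (fst (\<omega> i))) (\<lambda>i. row_left G (fst (\<omega> i)))]"
proof -
  have al: "\<omega> i \<in> alphabet G" for i using assms by (simp add: sequences_def)
  have fst_al: "fst (\<omega> i) < gls_J G" for i using al[of i] by (cases "\<omega> i") auto
  obtain \<rho> where \<rho>: "\<rho> < 1" "\<And>e. e \<in> alphabet G \<Longrightarrow> gls_q G e \<le> \<rho>" "\<And>j. j < gls_J G \<Longrightarrow> gls_p G j \<le> \<rho>"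
    using contraction_ratio by metis
  interpret X: affine_code "\<lambda>i. hor_a G (\<omega> i)" "\<lambda>i. hor_v G (\<omega> i)" \<rho>
    by (rule hor_code) (simp_all add: \<rho> al)
  interpret Y: affine_code "\<lambda>i. gls_p G (fst (\<omega> i))" "\<lambda>i. row_left G (fst (\<omega> i))" \<rho>
    by (rule row_code) (simp_all add: \<rho> fst_al)
  have A: "gls_A G e = vector [vector [hor_a G e, 0], vector [0, gls_p G (fst e)]]" for e
    by (cases e) (simp add: hor_a_def)
  have V: "gls_v G e = vector [hor_v G e, row_left G (fst e)]" for e
    by (cases e) (simp add: hor_v_def row_left_def)
  have prod: "gls_A_prod G \<omega> n =
      vector [vector [\<Prod>k<n. hor_a G (\<omega> k), 0], vector [0, \<Prod>k<n. gls_p G (fst (\<omega> k))]]" for n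
    by (induction n) (auto simp: A vec_eq_iff forall_2 mat_def matrix_matrix_mult_def sum_2)
  have summand: "gls_A_prod G \<omega> n *v gls_v G (\<omega> n) =
      vector [(\<Prod>k<n. hor_a G (\<omega> k)) * hor_v G (\<omega> n),
              (\<Prod>k<n. gls_p G (fst (\<omega> k))) * row_left G (fst (\<omega> n))]" for n
    by (simp add: prod V vec_eq_iff forall_2 matrix_vector_mult_def sum_2)
  have "(\<lambda>n. gls_A_prod G \<omega> n *v gls_v G (\<omega> n)) sums
      vector [affine_point (\<lambda>i. hor_a G (\<omega> i)) (\<lambda>i. hor_v G (\<omega> i)),
              affine_point (\<lambda>i. gls_p G (fst (\<omega> i))) (\<lambda>i. row_left G (fst (\<omega> i)))]"
    unfolding sums_def
  proof (rule vec_tendstoI)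
    fix i :: 2
    have "i = 1 \<or> i = 2" using exhaust_2 by blast
    then show "(\<lambda>n. (\<Sum>i<n. gls_A_prod G \<omega> i *v gls_v G (\<omega> i)) $ i) \<longlonglongrightarrow>
      vector [affine_point (\<lambda>i. hor_a G (\<omega> i)) (\<lambda>i. hor_v G (\<omega> i)),
              affine_point (\<lambda>i. gls_p G (fst (\<omega> i))) (\<lambda>i. row_left G (fst (\<omega> i)))] $ i"
      using summable_LIMSEQ[OF X.summable_code] summable_LIMSEQ[OF Y.summable_code]
      by (auto simp: summand affine_point_def)
  qed
  then show ?thesis unfolding gls_pi_def by (rule sums_unique[symmetric])
qed

end

section \<open>Uniqueness of the row sequence\<close>

context gls_system
begin

definition row_point :: "(nat \<Rightarrow> nat) \<Rightarrow> real" where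
  "row_point J = affine_point (\<lambda>i. gls_p G (J i)) (\<lambda>i. row_left G (J i))"

lemma row_code_exists:
  assumes "\<And>i. J i < gls_J G"
  obtains \<rho> where "affine_code (\<lambda>i. gls_p G (J i)) (\<lambda>i. row_left G (J i)) \<rho>"
proof -
  obtain \<rho> where "\<rho> < 1" "\<And>j. j < gls_J G \<Longrightarrow> gls_p G j \<le> \<rho>"
    using contraction_ratio by metis
  then have "affine_code (\<lambda>i. gls_p G (J i)) (\<lambda>i. row_left G (J i)) \<rho>"
    using assms by (intro row_code) auto
  then show ?thesis by (rule that)
qed

lemma row_point_unit:
  assumes "\<And>i. J i < gls_J G"
  shows "row_point J \<in> {0..1}"
proof -
  obtain \<rho> where "affine_code (\<lambda>i. gls_p G (J i)) (\<lambda>i. row_left G (J i)) \<rho>"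
    using row_code_exists[of J] assms by blast
  then show ?thesis unfolding row_point_def by (rule affine_code.affine_point_unit)
qed

lemma row_point_shift:
  assumes "\<And>i. J i < gls_J G"
  shows "row_point J = affine_iter (\<lambda>i. gls_p G (J i)) (\<lambda>i. row_left G (J i)) n (row_point (\<lambda>i. J (i + n)))"
proof -
  obtain \<rho> where "affine_code (\<lambda>i. gls_p G (J i)) (\<lambda>i. row_left G (J i)) \<rho>"
    using row_code_exists[of J] assms by blast
  then show ?thesis unfolding row_point_def by (rule affine_code.affine_point_shift)
qed

lemma row_point_eq_0:
  assumes rows: "\<And>i. J i < gls_J G" and "row_point J = 0"
  shows "J i = 0"
proof (rule ccontr)
  assume "J i \<noteq> 0"
  obtain \<rho> where c: "affine_code (\<lambda>i. gls_p G (J i)) (\<lambda>i. row_left G (J i)) \<rho>"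
    using row_code_exists[of J] rows by blast
  have P: "0 < (\<Prod>k<n. gls_p G (J k))" for n
    using rows p_pos by (intro prod_pos) auto
  have "0 \<le> row_left G (J n)" for n
    using row_left_mono[of 0 "J n"] rows[of n] by (simp add: row_left_def)
  then have "0 \<le> (\<Prod>k<n. gls_p G (J k)) * row_left G (J n)" for n
    using P[of n] by simp
  then have "(\<Prod>k<i. gls_p G (J k)) * row_left G (J i) = 0"
    using suminf_eq_zero_iff[OF affine_code.summable_code[OF c]] assms(2)
    by (simp add: row_point_def affine_point_def)
  moreover have "0 < (\<Prod>k<i. gls_p G (J k)) * row_left G (J i)"
    using P[of i] row_left_pos[of "J i"] rows[of i] \<open>J i \<noteq> 0\<close> by (intro mult_pos_pos) auto
  ultimately show False by linarith
qed

text \<open>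
  Two adjacent row strips share only their common boundary, which is the bottom of the upper strip.
  So if two codings of one height first differ at \<open>m\<close>, the upper one continues with height \<open>0\<close>,
  and height \<open>0\<close> is coded by row \<open>0\<close> only.
\<close>
lemma row_order_forces_zero_tail:
  assumes J: "\<And>i. J i < gls_J G" and J': "\<And>i. J' i < gls_J G"
    and eq: "row_point J = row_point J'" and m: "\<And>i. i < m \<Longrightarrow> J i = J' i" "J m < J' m"
  shows "J' (i + Suc m) = 0"
proof (rule row_point_eq_0[of "\<lambda>i. J' (i + Suc m)"])
  let ?t = "row_point (\<lambda>i. J (i + Suc m))" and ?t' = "row_point (\<lambda>i. J' (i + Suc m))"
  let ?it = "\<lambda>J. affine_iter (\<lambda>i. gls_p G (J i)) (\<lambda>i. row_left G (J i))"
  show "J' (i + Suc m) < gls_J G" for i by (rule J')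
  have t: "?t \<in> {0..1}" "?t' \<in> {0..1}" using J J' by (auto simp del: atLeastAtMost_iff intro!: row_point_unit)
  have "?it J m (row_left G (J m) + gls_p G (J m) * ?t) = ?it J' m (row_left G (J' m) + gls_p G (J' m) * ?t')"
    using row_point_shift[of J "Suc m"] row_point_shift[of J' "Suc m"] J J' eq
    by (simp add: affine_iter_Suc)
  also have "?it J' m (row_left G (J' m) + gls_p G (J' m) * ?t') = ?it J m (row_left G (J' m) + gls_p G (J' m) * ?t')"
    using m(1) by (intro affine_iter_cong) auto
  finally have "(\<Prod>k<m. gls_p G (J k)) *
      ((row_left G (J m) + gls_p G (J m) * ?t) - (row_left G (J' m) + gls_p G (J' m) * ?t')) = 0"
    by (simp flip: affine_iter_diff[of _ "\<lambda>i. row_left G (J i)"])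
  moreover have "0 < (\<Prod>k<m. gls_p G (J k))"
    using J p_pos by (intro prod_pos) auto
  ultimately have "(row_left G (J m) + gls_p G (J m) * ?t) - (row_left G (J' m) + gls_p G (J' m) * ?t') = 0"
    by (metis mult_eq_0_iff order_less_irrefl)
  then have "row_left G (J m) + gls_p G (J m) * ?t = row_left G (J' m) + gls_p G (J' m) * ?t'"
    by simp
  moreover have "gls_p G (J m) * ?t \<le> gls_p G (J m)"
    using t(1) p_pos[OF J[of m]] by (simp add: mult_left_le)
  moreover have "row_left G (J m) + gls_p G (J m) \<le> row_left G (J' m)"
    using row_left_mono[of "Suc (J m)" "J' m"] m(2) J'[of m] by (simp add: row_left_Suc)
  ultimately have "gls_p G (J' m) * ?t' \<le> 0" by simp
  then show "?t' = 0"
    using t(2) p_pos[OF J'[of m]] by (simp add: mult_le_0_iff)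
qed

lemma eventually_zero_frequency:
  assumes "\<And>i. J (i + m) = (0 :: nat)" "has_frequency J 1 a"
  shows "a = 0"
proof -
  have "(\<lambda>n. real (card {i. i < n \<and> J i = 1}) / real n) \<longlonglongrightarrow> 0"
  proof (rule tendsto_sandwich[where f = "\<lambda>_. 0" and h = "\<lambda>n. real m / real n"])
    have "real (card {i. i < n \<and> J i = 1}) / real n \<le> real m / real n" for n
    proof -
      have "J i = 0" if "m \<le> i" for i using assms(1)[of "i - m"] that by simp
      then have "{i. i < n \<and> J i = 1} \<subseteq> {..<m}" by (force simp: not_less[symmetric])
      then have "card {i. i < n \<and> J i = 1} \<le> m" using card_mono[of "{..<m}"] by simp
      then show ?thesis by (intro divide_right_mono) auto
    qed
    then show "\<forall>\<^sub>F n in sequentially. real (card {i. i < n \<and> J i = 1}) / real n \<le> real m / real n"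
      by simp
    show "(\<lambda>n. real m / real n) \<longlonglongrightarrow> 0" by (rule lim_const_over_n)
  qed auto
  then show ?thesis using assms(2) LIMSEQ_unique unfolding has_frequency_def by blast
qed

text \<open>
  Row \<open>1\<close> exists because there are at least two rows; its positive frequency excludes a tail of zeros.
\<close>
lemma row_sequence_unique:
  assumes J: "\<And>i. J i < gls_J G" and J': "\<And>i. J' i < gls_J G"
    and freq: "has_frequency J 1 a" "has_frequency J' 1 a" "0 < a"
    and eq: "row_point J = row_point J'"
  shows "J = J'"
proof (rule ccontr)
  assume "J \<noteq> J'"
  then obtain m0 where m0: "J m0 \<noteq> J' m0" by blast
  define m where "m = (LEAST m. J m \<noteq> J' m)"
  have m: "J m \<noteq> J' m" unfolding m_def using m0 by (rule LeastI)
  have before: "J i = J' i" if "i < m" for i using not_less_Least that unfolding m_def by blast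
  show False
  proof (cases "J m < J' m")
    case True
    then have "J' (i + Suc m) = 0" for i
      using row_order_forces_zero_tail[of J J' m] J J' eq before by blast
    then show False using eventually_zero_frequency[of J' "Suc m" a] freq by simp
  next
    case False
    then have "J' m < J m" using m by simp
    then have "J (i + Suc m) = 0" for i
      using row_order_forces_zero_tail[of J' J m] J J' eq[symmetric] before by metis
    then show False using eventually_zero_frequency[of J "Suc m" a] freq by simp
  qed
qed

lemma sequence_row: 
  assumes "\<omega> \<in> sequences G" shows "fst (\<omega> i) < gls_J G"
proof -
  have "\<omega> i \<in> alphabet G" using assms by (simp add: sequences_def)
  then show ?thesis by (cases "\<omega> i") auto
qed

lemma level_set_code:
  "x \<in> level_set G \<alpha> y \<longleftrightarrow> (\<exists>\<omega>\<in>sequences G. x = affine_point (\<lambda>i. hor_a G (\<omega> i)) (\<lambda>i. hor_v G (\<omega> i)) \<and>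
     y = row_point (\<lambda>i. fst (\<omega> i)) \<and> (\<forall>e\<in>alphabet G. has_frequency \<omega> e (\<alpha> e)))" (is "_ \<longleftrightarrow> ?R")
proof -
  have v: "vector [a, b] = (vector [c, d] :: real^2) \<longleftrightarrow> a = c \<and> b = d" for a b c d
    by (auto simp: vec_eq_iff forall_2)
  have unit: "affine_point (\<lambda>i. hor_a G (\<omega> i)) (\<lambda>i. hor_v G (\<omega> i)) \<in> {0..1}" if "\<omega> \<in> sequences G" for \<omega>
  proof -
    obtain \<rho> where \<rho>: "\<rho> < 1" "\<And>e. e \<in> alphabet G \<Longrightarrow> gls_q G e \<le> \<rho>"
      using contraction_ratio by metis
    have "affine_code (\<lambda>i. hor_a G (\<omega> i)) (\<lambda>i. hor_v G (\<omega> i)) \<rho>"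
      using \<rho> that by (intro hor_code) (auto simp: sequences_def)
    then show ?thesis by (rule affine_code.affine_point_unit)
  qed
  show ?thesis
    unfolding level_set_def using unit by (auto simp: gls_pi_eq v row_point_def simp del: atLeastAtMost_iff)
qed

lemma row_has_frequency:
  assumes "\<omega> \<in> sequences G" "\<forall>e\<in>alphabet G. has_frequency \<omega> e (\<alpha> e)" "j < gls_J G"
  shows "has_frequency (\<lambda>i. fst (\<omega> i)) j (row_frequency G \<alpha> j)"
proof -
  have "(\<lambda>n. (\<Sum>i<n. of_bool (fst (\<omega> i) = j)) / real n) \<longlonglongrightarrow> (\<Sum>e\<in>alphabet G. \<alpha> e * of_bool (fst e = j))"
    using assms(1,2) by (intro frequency_average finite_alphabet) (auto simp: sequences_def)
  also have "(\<Sum>e\<in>alphabet G. \<alpha> e * of_bool (fst e = j)) = row_frequency G \<alpha> j"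
  proof -
    have "(\<Sum>e\<in>alphabet G. \<alpha> e * of_bool (fst e = j)) =
        (\<Sum>i<gls_J G. if i = j then row_frequency G \<alpha> i else 0)"
      unfolding sum_alphabet row_frequency_def by (intro sum.cong) auto
    then show ?thesis using assms(3) by simp
  qed
  finally show ?thesis by (simp add: has_frequency_of_bool)
qed

end

section \<open>The fibre over a row sequence\<close>

locale gls_fibre = gls_system +
  fixes J :: "nat \<Rightarrow> nat"
  assumes rows: "J i < gls_J G"
begin

definition digits :: "(nat \<Rightarrow> nat) \<Rightarrow> bool" where
  "digits \<omega> \<longleftrightarrow> (\<forall>i. \<omega> i < gls_B G (J i))"

definition fibre_iter :: "(nat \<Rightarrow> nat) \<Rightarrow> nat \<Rightarrow> real \<Rightarrow> real" where
  "fibre_iter \<omega> = affine_iter (\<lambda>i. hor_a G (J i, \<omega> i)) (\<lambda>i. hor_v G (J i, \<omega> i))"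

definition fibre_point :: "(nat \<Rightarrow> nat) \<Rightarrow> real" where
  "fibre_point \<omega> = affine_point (\<lambda>i. hor_a G (J i, \<omega> i)) (\<lambda>i. hor_v G (J i, \<omega> i))"

definition len :: "(nat \<Rightarrow> nat) \<Rightarrow> nat \<Rightarrow> real" where
  "len \<omega> n = (\<Prod>i<n. gls_q G (J i, \<omega> i))"

lemma len_0 [simp]: "len \<omega> 0 = 1"
  by (simp add: len_def)

lemma len_Suc: "len \<omega> (Suc n) = len \<omega> n * gls_q G (J n, \<omega> n)"
  by (simp add: len_def)

lemma len_cong: "(\<And>i. i < n \<Longrightarrow> \<omega> i = \<omega>' i) \<Longrightarrow> len \<omega> n = len \<omega>' n"
  by (simp add: len_def del: gls_q.simps)

lemma fibre_iter_cong: "(\<And>i. i < n \<Longrightarrow> \<omega> i = \<omega>' i) \<Longrightarrow> fibre_iter \<omega> n t = fibre_iter \<omega>' n t"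
  unfolding fibre_iter_def by (rule affine_iter_cong) auto

lemma len_pos: "(\<And>i. i < n \<Longrightarrow> \<omega> i < gls_B G (J i)) \<Longrightarrow> 0 < len \<omega> n"
  unfolding len_def using rows q_pos by (intro prod_pos) (auto simp del: gls_q.simps)

lemma abs_fibre_iter_diff:
  assumes "\<And>i. i < n \<Longrightarrow> \<omega> i < gls_B G (J i)"
  shows "\<bar>fibre_iter \<omega> n t - fibre_iter \<omega> n u\<bar> = len \<omega> n * \<bar>t - u\<bar>"
proof -
  have "\<bar>\<Prod>i<n. hor_a G (J i, \<omega> i)\<bar> = len \<omega> n"
    unfolding len_def abs_prod using assms rows
    by (intro prod.cong) (auto simp: abs_hor_a simp del: gls_q.simps)
  then show ?thesis
    by (simp add: fibre_iter_def affine_iter_diff abs_mult)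
qed

lemma len_le_power:
  assumes "\<And>e. e \<in> alphabet G \<Longrightarrow> gls_q G e \<le> \<rho>" "\<And>i. i < n \<Longrightarrow> \<omega> i < gls_B G (J i)"
  shows "len \<omega> n \<le> \<rho> ^ n"
proof -
  have "len \<omega> n \<le> (\<Prod>i<n. \<rho>)"
    unfolding len_def using assms q_pos rows
    by (intro prod_mono) (auto simp: less_imp_le simp del: gls_q.simps)
  then show ?thesis by simp
qed

lemma power_le_len:
  assumes "\<And>e. e \<in> alphabet G \<Longrightarrow> \<kappa> \<le> gls_q G e" "0 \<le> \<kappa>" "\<And>i. i < n \<Longrightarrow> \<omega> i < gls_B G (J i)"
  shows "\<kappa> ^ n \<le> len \<omega> n"
proof -
  have "(\<Prod>i<n. \<kappa>) \<le> len \<omega> n"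
    unfolding len_def using assms rows
    by (intro prod_mono) (auto simp del: gls_q.simps)
  then show ?thesis by simp
qed

lemma fibre_code:
  assumes "digits \<omega>"
  obtains \<rho> where "affine_code (\<lambda>i. hor_a G (J i, \<omega> i)) (\<lambda>i. hor_v G (J i, \<omega> i)) \<rho>"
proof -
  obtain \<rho> where "\<rho> < 1" "\<And>e. e \<in> alphabet G \<Longrightarrow> gls_q G e \<le> \<rho>"
    using contraction_ratio by metis
  then have "affine_code (\<lambda>i. hor_a G (J i, \<omega> i)) (\<lambda>i. hor_v G (J i, \<omega> i)) \<rho>"
    using assms rows by (intro hor_code) (auto simp: digits_def)
  then show ?thesis by (rule that)
qed

lemma fibre_point_cell:
  assumes "digits \<omega>"
  shows "fibre_point \<omega> \<in> fibre_iter \<omega> n ` {0..1}"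
proof -
  obtain \<rho> where "affine_code (\<lambda>i. hor_a G (J i, \<omega> i)) (\<lambda>i. hor_v G (J i, \<omega> i)) \<rho>"
    using fibre_code[OF assms] .
  from affine_code.affine_point_cylinder[OF this, of n] show ?thesis
    unfolding fibre_point_def fibre_iter_def by blast
qed

lemma fibre_iter_nested:
  assumes "digits \<omega>" "m \<le> n" "t \<in> {0..1}"
  obtains u where "u \<in> {0..1}" "fibre_iter \<omega> n t = fibre_iter \<omega> m u"
proof -
  obtain \<rho> where "affine_code (\<lambda>i. hor_a G (J i, \<omega> i)) (\<lambda>i. hor_v G (J i, \<omega> i)) \<rho>"
    using fibre_code[OF assms(1)] .
  from affine_code.affine_iter_nested[OF this assms(2,3)] show ?thesis
    using that unfolding fibre_iter_def by blast
qed

lemma diameter_cell: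
  assumes "\<And>i. i < n \<Longrightarrow> \<omega> i < gls_B G (J i)"
  shows "bounded (fibre_iter \<omega> n ` {0..1})" "diameter (fibre_iter \<omega> n ` {0..1}) \<le> len \<omega> n"
proof -
  have le: "dist x y \<le> len \<omega> n" if "x \<in> fibre_iter \<omega> n ` {0..1}" "y \<in> fibre_iter \<omega> n ` {0..1}" for x y
  proof -
    obtain t u where tu: "x = fibre_iter \<omega> n t" "y = fibre_iter \<omega> n u" "t \<in> {0..1}" "u \<in> {0..1}"
      using \<open>x \<in> _\<close> \<open>y \<in> _\<close> by (auto simp del: atLeastAtMost_iff)
    have "len \<omega> n * \<bar>t - u\<bar> \<le> len \<omega> n * 1"
      using less_imp_le[OF len_pos[OF assms, of n]] tu by (intro mult_left_mono) auto
    then show ?thesis using abs_fibre_iter_diff[OF assms, of n] tu by (simp add: dist_real_def)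
  qed
  show "bounded (fibre_iter \<omega> n ` {0..1})"
    unfolding bounded_two_points using le by blast
  show "diameter (fibre_iter \<omega> n ` {0..1}) \<le> len \<omega> n"
    using le len_pos[OF assms, of n] by (intro diameter_le) (auto simp: less_imp_le dist_real_def)
qed

section \<open>Covering a fibre by words of large weight\<close>

definition words :: "nat \<Rightarrow> nat list set" where
  "words n = {w. length w = n \<and> (\<forall>i<n. w ! i < gls_B G (J i))}"

lemma words_Suc: "words (Suc n) = (\<lambda>(w, k). w @ [k]) ` (words n \<times> {..<gls_B G (J n)})"
proof (intro set_eqI iffI)
  fix w assume w: "w \<in> words (Suc n)"
  then have "w = butlast w @ [last w]"
    by (metis (mono_tags, lifting) append_butlast_last_id length_0_conv mem_Collect_eq nat.distinct(1) words_def)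
  then obtain u k where u: "w = u @ [k]" by blast
  then have len: "length u = n" using w by (simp add: words_def)
  have "u ! i < gls_B G (J i)" if "i < n" for i
    using w that u len by (auto simp: words_def nth_append all_conj_distrib dest!: spec[of _ i])
  moreover have "k < gls_B G (J n)" using w u len by (auto simp: words_def dest!: spec[of _ n])
  ultimately show "w \<in> (\<lambda>(w, k). w @ [k]) ` (words n \<times> {..<gls_B G (J n)})"
    using u len by (auto simp: words_def)
qed (auto simp: words_def nth_append less_Suc_eq)

lemma finite_words: "finite (words n)"
  by (induction n) (auto simp: words_Suc, simp add: words_def)

lemma sum_words:
  fixes b :: "nat \<times> nat \<Rightarrow> real"
  assumes "\<And>j. j < gls_J G \<Longrightarrow> (\<Sum>k<gls_B G j. b (j, k)) = 1"
  shows "(\<Sum>w\<in>words n. \<Prod>i<n. b (J i, w ! i)) = 1"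
proof (induction n)
  case 0
  have "words 0 = {[]}" by (auto simp: words_def)
  then show ?case by simp
next
  case (Suc n)
  have "inj_on (\<lambda>(w, k). w @ [k]) (words n \<times> {..<gls_B G (J n)})"
    by (auto simp: inj_on_def)
  then have "(\<Sum>w\<in>words (Suc n). \<Prod>i<Suc n. b (J i, w ! i)) =
      (\<Sum>(w, k)\<in>words n \<times> {..<gls_B G (J n)}. \<Prod>i<Suc n. b (J i, (w @ [k]) ! i))"
    unfolding words_Suc by (subst sum.reindex) (auto intro!: sum.cong simp del: prod.lessThan_Suc)
  also have "\<dots> = (\<Sum>(w, k)\<in>words n \<times> {..<gls_B G (J n)}. (\<Prod>i<n. b (J i, w ! i)) * b (J n, k))"
    by (intro sum.cong) (auto simp: words_def nth_append)
  also have "\<dots> = (\<Sum>w\<in>words n. (\<Prod>i<n. b (J i, w ! i)) * (\<Sum>k<gls_B G (J n). b (J n, k)))"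
    by (simp add: sum.cartesian_product[symmetric] sum_distrib_left)
  also have "\<dots> = 1" using Suc assms rows by simp
  finally show ?case .
qed

text \<open>
  The covering consists of the cells of all words of length at least \<open>N\<close> that satisfy the inequality
  in the last hypothesis. The weights of the words of length \<open>n\<close> add up to \<open>1\<close>, so those words contribute at
  most \<open>exp (- c) ^ n\<close>, and the total is a tail of a geometric series.
\<close>
lemma hausdorff_measure_0_of_weights:
  fixes b :: "nat \<times> nat \<Rightarrow> real"
  assumes b: "\<And>e. e \<in> alphabet G \<Longrightarrow> 0 \<le> b e"
      "\<And>j. j < gls_J G \<Longrightarrow> (\<Sum>k<gls_B G j. b (j, k)) = 1"
    and s: "0 < s" and c: "0 < c"
    and X: "\<And>x. x \<in> X \<Longrightarrow> \<exists>\<omega>. digits \<omega> \<and> x = fibre_point \<omega> \<and>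
      (\<forall>\<^sub>F n in sequentially. len \<omega> n powr s \<le> exp (- c) ^ n * (\<Prod>i<n. b (J i, \<omega> i)))"
  shows "hausdorff_measure s X = 0"
  unfolding hausdorff_measure_eq_0_iff
proof (intro allI impI)
  fix \<delta> \<epsilon> :: real assume pos: "0 < \<delta>" "0 < \<epsilon>"
  obtain \<rho> where \<rho>: "\<rho> < 1" "\<And>e. e \<in> alphabet G \<Longrightarrow> gls_q G e \<le> \<rho>"
    using contraction_ratio by metis
  have "(0, 0) \<in> alphabet G" using two_rows two_digits[of 0] by simp
  then have \<rho>0: "0 \<le> \<rho>" using \<rho>(2) q_pos by (meson less_le_trans less_imp_le)
  have "(\<lambda>n. \<rho> ^ n) \<longlonglongrightarrow> 0" using \<rho> \<rho>0 by (intro LIMSEQ_power_zero) auto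
  then have "\<forall>\<^sub>F n in sequentially. \<rho> ^ n < \<delta>" using pos by (simp add: order_tendstoD)
  then obtain N1 where N1: "\<And>n. n \<ge> N1 \<Longrightarrow> \<rho> ^ n < \<delta>"
    unfolding eventually_sequentially by blast
  have "summable (\<lambda>n. exp (- c) ^ n)" using c by (intro summable_geometric) auto
  then obtain N2 where N2: "\<And>m n. m \<ge> N2 \<Longrightarrow> norm (\<Sum>i=m..<n. exp (- c) ^ i) < \<epsilon> / 2"
    unfolding summable_Cauchy using pos half_gt_zero by metis
  define N where "N = max N1 N2"
  define g where "g w = exp (- c) ^ length w * (\<Prod>i<length w. b (J i, w ! i))" for w
  define good where "good w \<longleftrightarrow> N \<le> length w \<and> w \<in> words (length w) \<and>
      len (\<lambda>i. w ! i) (length w) powr s \<le> g w" for w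
  define V where "V w = (if good w then fibre_iter (\<lambda>i. w ! i) (length w) ` {0..1} else {})" for w
  have V_cell: "bounded (V w)" "diameter (V w) \<le> len (\<lambda>i. w ! i) (length w)" "len (\<lambda>i. w ! i) (length w) \<le> \<delta>"
    if "good w" for w
  proof -
    have w: "w ! i < gls_B G (J i)" if "i < length w" for i
      using \<open>good w\<close> that by (auto simp: good_def words_def)
    show "bounded (V w)" "diameter (V w) \<le> len (\<lambda>i. w ! i) (length w)"
      using diameter_cell[of "length w" "\<lambda>i. w ! i"] w that by (auto simp: V_def)
    have "len (\<lambda>i. w ! i) (length w) \<le> \<rho> ^ length w" using len_le_power \<rho>(2) w by blast
    then show "len (\<lambda>i. w ! i) (length w) \<le> \<delta>"
      using N1[of "length w"] that by (auto simp: good_def N_def)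
  qed
  have g_nonneg: "0 \<le> g w" if "w \<in> words n" for w n
    unfolding g_def using that rows b(1) by (intro mult_nonneg_nonneg prod_nonneg) (auto simp: words_def)
  have diam_V: "diam_pow s (V w) \<le> (if good w then ennreal (g w) else 0)" for w
  proof (cases "good w")
    case True
    have "diameter (V w) powr s \<le> len (\<lambda>i. w ! i) (length w) powr s"
      using V_cell[OF True] s by (intro powr_mono2) (auto intro: diameter_ge_0)
    also have "\<dots> \<le> g w" using True by (simp add: good_def)
    finally show ?thesis using True s by (auto simp: diam_pow_def V_def intro!: ennreal_leI)
  qed (simp add: diam_pow_def V_def)
  \<comment> \<open>A bijection between \<open>nat\<close> and words turns the family of cells into a sequence; words that are not good get the empty set.\<close>
  define U where "U i = V (list_decode i)" for i
  have "X \<subseteq> (\<Union>i. U i)"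
  proof
    fix x assume "x \<in> X"
    then obtain \<omega> N3 where \<omega>: "digits \<omega>" "x = fibre_point \<omega>"
      "\<And>n. n \<ge> N3 \<Longrightarrow> len \<omega> n powr s \<le> exp (- c) ^ n * (\<Prod>i<n. b (J i, \<omega> i))"
      using X unfolding eventually_sequentially by metis
    define n where "n = max N N3"
    define w where "w = map \<omega> [0..<n]"
    have w: "length w = n" "\<And>i. i < n \<Longrightarrow> w ! i = \<omega> i" by (auto simp: w_def)
    have "len (\<lambda>i. w ! i) n = len \<omega> n" using w by (intro len_cong) auto
    moreover have "g w = exp (- c) ^ n * (\<Prod>i<n. b (J i, \<omega> i))"
      using w by (simp add: g_def)
    ultimately have "good w"
      using w \<omega>(1) \<omega>(3)[of n] by (auto simp: good_def n_def words_def digits_def)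
    have "x \<in> fibre_iter \<omega> n ` {0..1}" using fibre_point_cell \<omega> by simp
    also have "fibre_iter \<omega> n ` {0..1} = V w"
      using \<open>good w\<close> w fibre_iter_cong[of n "\<lambda>i. w ! i" \<omega>] by (auto simp: V_def)
    finally have "x \<in> U (list_encode w)" by (simp add: U_def)
    then show "x \<in> (\<Union>i. U i)" by blast
  qed
  moreover have "bounded (U i) \<and> diameter (U i) \<le> \<delta>" for i
  proof (cases "good (list_decode i)")
    case True
    then show ?thesis using V_cell[OF True] by (auto simp: U_def)
  qed (use pos in \<open>simp add: U_def V_def\<close>)
  moreover have "(\<Sum>i. diam_pow s (U i)) < ennreal \<epsilon>"
  proof -
    have "(\<Sum>i<m. diam_pow s (U i)) \<le> ennreal (\<epsilon> / 2)" for m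
    proof -
      define S where "S = {w \<in> list_decode ` {..<m}. good w}"
      have finS: "finite S" by (simp add: S_def)
      define K where "K = Suc (Max (insert 0 (length ` S)))"
      have K: "length w < K" if "w \<in> S" for w
        using finS that by (auto simp: K_def less_Suc_eq_le intro!: Max_ge)
      have sub: "S \<subseteq> (\<Union>n\<in>{N..<K}. words n)"
        using K by (force simp: S_def good_def)
      have "(\<Sum>i<m. diam_pow s (U i)) = (\<Sum>w\<in>list_decode ` {..<m}. diam_pow s (V w))"
        unfolding U_def by (subst sum.reindex[OF inj_list_decode]) simp
      also have "\<dots> \<le> (\<Sum>w\<in>list_decode ` {..<m}. if good w then ennreal (g w) else 0)"
        by (intro sum_mono diam_V)
      also have "\<dots> = (\<Sum>w\<in>S. ennreal (g w))"
        unfolding S_def by (simp add: sum.inter_filter)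
      also have "\<dots> = ennreal (\<Sum>w\<in>S. g w)"
        by (intro sum_ennreal) (auto simp: S_def good_def intro: g_nonneg)
      also have "(\<Sum>w\<in>S. g w) \<le> (\<Sum>w\<in>(\<Union>n\<in>{N..<K}. words n). g w)"
        using sub finite_words g_nonneg by (intro sum_mono2) auto
      also have "\<dots> = (\<Sum>n=N..<K. \<Sum>w\<in>words n. g w)"
        using finite_words by (intro sum.UNION_disjoint) (auto simp: words_def)
      also have "\<dots> = (\<Sum>n=N..<K. exp (- c) ^ n)"
      proof (intro sum.cong refl)
        fix n
        have "(\<Sum>w\<in>words n. g w) = exp (- c) ^ n * (\<Sum>w\<in>words n. \<Prod>i<n. b (J i, w ! i))"
          unfolding sum_distrib_left by (intro sum.cong) (auto simp: g_def words_def)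
        then show "(\<Sum>w\<in>words n. g w) = exp (- c) ^ n" using sum_words b(2) by simp
      qed
      also have "\<dots> \<le> \<epsilon> / 2" using N2[of N K] by (simp add: N_def)
      finally show ?thesis by (simp add: ennreal_leI)
    qed
    then have "(\<Sum>i. diam_pow s (U i)) \<le> ennreal (\<epsilon> / 2)"
      by (intro suminf_le_const) auto
    also have "\<dots> < ennreal \<epsilon>" using pos by (simp add: ennreal_less_iff)
    finally show ?thesis .
  qed
  ultimately show "\<exists>U. X \<subseteq> (\<Union>i. U i) \<and> (\<forall>i. bounded (U i) \<and> diameter (U i) \<le> \<delta>) \<and>
      (\<Sum>i. diam_pow s (U i)) < ennreal \<epsilon>"
    by blast
qed

section \<open>Mass distribution on a fibre\<close>

lemma ratio_lower_bound:
  obtains \<kappa> where "0 < \<kappa>" "\<kappa> < 1" "\<And>e. e \<in> alphabet G \<Longrightarrow> \<kappa> \<le> gls_q G e"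
proof -
  let ?S = "gls_q G ` alphabet G"
  have mem: "(0, 0) \<in> alphabet G" using two_rows two_digits[of 0] by simp
  have fin: "finite ?S" "?S \<noteq> {}" using finite_alphabet mem by blast+
  show ?thesis
  proof (rule that[of "Min ?S"])
    show "0 < Min ?S" using fin q_pos by auto
    have "Min ?S \<in> ?S" using fin by (rule Min_in)
    then show "Min ?S < 1" using q_less_1 by auto
  qed (use fin in \<open>auto intro!: Min_le\<close>)
qed

text \<open>
  The left endpoint of a cell; the maps may reverse the orientation.
\<close>
definition lo :: "(nat \<Rightarrow> nat) \<Rightarrow> nat \<Rightarrow> real" where
  "lo \<omega> n = min (fibre_iter \<omega> n 0) (fibre_iter \<omega> n 1)"

lemma lo_cong: "(\<And>i. i < n \<Longrightarrow> \<omega> i = \<omega>' i) \<Longrightarrow> lo \<omega> n = lo \<omega>' n"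
  using fibre_iter_cong[of n \<omega> \<omega>'] by (simp add: lo_def)

lemma lo_ends:
  assumes "\<And>i. i < n \<Longrightarrow> \<omega> i < gls_B G (J i)"
  obtains t u where "t \<in> {0..1}" "u \<in> {0..1}" "fibre_iter \<omega> n t = lo \<omega> n" "fibre_iter \<omega> n u = lo \<omega> n + len \<omega> n"
proof (cases "fibre_iter \<omega> n 0 \<le> fibre_iter \<omega> n 1")
  case True
  then show ?thesis
    using abs_fibre_iter_diff[OF assms, of n 0 1] by (intro that[of 0 1]) (auto simp: lo_def)
next
  case False
  then show ?thesis
    using abs_fibre_iter_diff[OF assms, of n 0 1] by (intro that[of 1 0]) (auto simp: lo_def)
qed

lemma cell_lo:
  assumes "\<And>i. i < n \<Longrightarrow> \<omega> i < gls_B G (J i)" "x \<in> fibre_iter \<omega> n ` {0..1}"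
  shows "\<bar>x - lo \<omega> n\<bar> \<le> len \<omega> n"
proof -
  obtain t where t: "x = fibre_iter \<omega> n t" "t \<in> {0..1}" using assms(2) by blast
  obtain u where u: "u \<in> {0..1}" "fibre_iter \<omega> n u = lo \<omega> n" using lo_ends[OF assms(1)] by metis
  have "len \<omega> n * \<bar>t - u\<bar> \<le> len \<omega> n * 1"
    using less_imp_le[OF len_pos[OF assms(1), of n]] t u by (intro mult_left_mono) auto
  then show ?thesis
    using abs_fibre_iter_diff[OF assms(1), of n t u] t u by simp
qed

text \<open>
  At the first difference \<open>m\<close> the two cells are the images, under one affine map, of subsets of two
  intervals of the partition of row \<open>J m\<close>. The sign of the slope of this map decides which comes first.
\<close>
lemma cells_ordered:
  assumes "digits \<omega>" "digits \<omega>'" "\<And>i. i < m \<Longrightarrow> \<omega> i = \<omega>' i" "\<omega> m < \<omega>' m" "m < n" "m < n'"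
  shows "(\<forall>t\<in>{0..1}. \<forall>u\<in>{0..1}. fibre_iter \<omega> n t \<le> fibre_iter \<omega>' n' u) \<or>
         (\<forall>t\<in>{0..1}. \<forall>u\<in>{0..1}. fibre_iter \<omega>' n' u \<le> fibre_iter \<omega> n t)"
proof -
  define P where "P = (\<Prod>k<m. hor_a G (J k, \<omega> k))"
  have step: "\<exists>z. z \<in> {gls_r G (J m, \<eta> m)..gls_r G (J m, Suc (\<eta> m))} \<and> fibre_iter \<eta> l t = fibre_iter \<eta> m z"
    if "digits \<eta>" "m < l" "t \<in> {0..1}" for \<eta> l t
  proof -
    obtain u where u: "u \<in> {0..1}" "fibre_iter \<eta> l t = fibre_iter \<eta> (Suc m) u"
      using fibre_iter_nested[of \<eta> "Suc m" l t] \<open>digits \<eta>\<close> \<open>m < l\<close> \<open>t \<in> _\<close> by (metis Suc_leI)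
    moreover have "hor_v G (J m, \<eta> m) + hor_a G (J m, \<eta> m) * u \<in> {gls_r G (J m, \<eta> m)..gls_r G (J m, Suc (\<eta> m))}"
      using that(1) rows u by (intro hor_map_range) (auto simp: digits_def)
    ultimately show ?thesis by (auto simp: fibre_iter_def affine_iter_Suc)
  qed
  have diff: "\<exists>z. 0 \<le> z \<and> fibre_iter \<omega>' n' u - fibre_iter \<omega> n t = P * z"
    if tu: "t \<in> {0..1}" "u \<in> {0..1}" for t u
  proof -
    obtain y where y: "y \<in> {gls_r G (J m, \<omega> m)..gls_r G (J m, Suc (\<omega> m))}" "fibre_iter \<omega> n t = fibre_iter \<omega> m y"
      using step[of \<omega> n t] assms(1,5) tu by blast
    obtain z where z: "z \<in> {gls_r G (J m, \<omega>' m)..gls_r G (J m, Suc (\<omega>' m))}" "fibre_iter \<omega>' n' u = fibre_iter \<omega>' m z"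
      using step[of \<omega>' n' u] assms(2,6) tu by blast
    have "gls_r G (J m, Suc (\<omega> m)) \<le> gls_r G (J m, \<omega>' m)"
      using assms(2,4) rows by (intro r_mono) (auto simp: digits_def less_imp_le)
    then have "0 \<le> z - y" using y z by auto
    moreover have "fibre_iter \<omega>' m z = fibre_iter \<omega> m z"
      using fibre_iter_cong[of m \<omega> \<omega>'] assms(3) by simp
    ultimately show ?thesis
      using y z by (intro exI[of _ "z - y"]) (simp add: fibre_iter_def affine_iter_diff P_def)
  qed
  show ?thesis
  proof (cases "0 \<le> P")
    case True
    have "fibre_iter \<omega> n t \<le> fibre_iter \<omega>' n' u" if "t \<in> {0..1}" "u \<in> {0..1}" for t u
      using diff[OF that] True by (metis diff_ge_0_iff_ge mult_nonneg_nonneg)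
    then show ?thesis by blast
  next
    case False
    have "fibre_iter \<omega>' n' u \<le> fibre_iter \<omega> n t" if "t \<in> {0..1}" "u \<in> {0..1}" for t u
      using diff[OF that] False by (metis diff_le_0_iff_le linorder_le_cases mult_nonpos_nonneg)
    then show ?thesis by blast
  qed
qed

lemma lo_separated:
  assumes "digits \<omega>" "digits \<omega>'" "\<And>i. i < m \<Longrightarrow> \<omega> i = \<omega>' i" "\<omega> m \<noteq> \<omega>' m" "m < n" "m < n'"
  shows "min (len \<omega> n) (len \<omega>' n') \<le> \<bar>lo \<omega> n - lo \<omega>' n'\<bar>"
proof -
  have valid: "\<And>i. i < n \<Longrightarrow> \<omega> i < gls_B G (J i)" "\<And>i. i < n' \<Longrightarrow> \<omega>' i < gls_B G (J i)"
    using assms(1,2) by (auto simp: digits_def)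
  obtain t u where tu: "t \<in> {0..1}" "u \<in> {0..1}" "fibre_iter \<omega> n t = lo \<omega> n" "fibre_iter \<omega> n u = lo \<omega> n + len \<omega> n"
    using lo_ends[OF valid(1)] by metis
  obtain t' u' where tu': "t' \<in> {0..1}" "u' \<in> {0..1}" "fibre_iter \<omega>' n' t' = lo \<omega>' n'"
      "fibre_iter \<omega>' n' u' = lo \<omega>' n' + len \<omega>' n'"
    using lo_ends[OF valid(2)] by metis
  have "(\<forall>t\<in>{0..1}. \<forall>u\<in>{0..1}. fibre_iter \<omega> n t \<le> fibre_iter \<omega>' n' u) \<or>
         (\<forall>t\<in>{0..1}. \<forall>u\<in>{0..1}. fibre_iter \<omega>' n' u \<le> fibre_iter \<omega> n t)"
  proof (cases "\<omega> m < \<omega>' m")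
    case True
    then show ?thesis using cells_ordered[of \<omega> \<omega>' m n n'] assms by blast
  next
    case False
    then have "\<omega>' m < \<omega> m" using assms(4) by simp
    then show ?thesis using cells_ordered[of \<omega>' \<omega> m n' n] assms by force
  qed
  then show ?thesis
  proof
    assume "\<forall>t\<in>{0..1}. \<forall>u\<in>{0..1}. fibre_iter \<omega> n t \<le> fibre_iter \<omega>' n' u"
    then have "fibre_iter \<omega> n u \<le> fibre_iter \<omega>' n' t'" using tu tu' by blast
    then show ?thesis using tu tu' by linarith
  next
    assume "\<forall>t\<in>{0..1}. \<forall>u\<in>{0..1}. fibre_iter \<omega>' n' u \<le> fibre_iter \<omega> n t"
    then have "fibre_iter \<omega>' n' u' \<le> fibre_iter \<omega> n t" using tu tu' by blast
    then show ?thesis using tu tu' by linarith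
  qed
qed

text \<open>
  Cutting every digit sequence at this time gives pairwise incomparable words whose cells all have
  length comparable to \<open>d\<close>.
\<close>
definition stop :: "real \<Rightarrow> (nat \<Rightarrow> nat) \<Rightarrow> nat" where
  "stop d \<omega> = (LEAST n. len \<omega> n \<le> d)"

lemma stop_props:
  assumes \<kappa>: "\<forall>e\<in>alphabet G. \<kappa> \<le> gls_q G e" "0 < \<kappa>" "\<kappa> < 1"
    and d: "0 < d" "d < \<kappa> ^ N" and \<omega>: "digits \<omega>"
  shows "len \<omega> (stop d \<omega>) \<le> d" "\<kappa> * d \<le> len \<omega> (stop d \<omega>)" "N \<le> stop d \<omega>"
    and "\<And>n. n < stop d \<omega> \<Longrightarrow> d < len \<omega> n"
proof -
  have valid: "\<omega> i < gls_B G (J i)" for i using \<omega> by (simp add: digits_def)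
  obtain \<rho> where \<rho>: "\<rho> < 1" "\<And>e. e \<in> alphabet G \<Longrightarrow> gls_q G e \<le> \<rho>"
    using contraction_ratio by metis
  have "(0, 0) \<in> alphabet G" using two_rows two_digits[of 0] by simp
  then have "0 \<le> \<rho>" using \<rho>(2) q_pos by (meson less_le_trans less_imp_le)
  then have "(\<lambda>n. \<rho> ^ n) \<longlonglongrightarrow> 0" using \<rho> by (intro LIMSEQ_power_zero) auto
  then have "\<forall>\<^sub>F n in sequentially. \<rho> ^ n < d" using d by (simp add: order_tendstoD)
  then obtain n where "\<rho> ^ n < d" unfolding eventually_sequentially by blast
  then have "len \<omega> n \<le> d" using len_le_power[OF \<rho>(2), of n \<omega>] valid by simp
  then show le: "len \<omega> (stop d \<omega>) \<le> d" unfolding stop_def by (rule LeastI)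
  show gt: "d < len \<omega> n" if "n < stop d \<omega>" for n
    using not_less_Least[of n "\<lambda>n. len \<omega> n \<le> d"] that unfolding stop_def by simp
  show N: "N \<le> stop d \<omega>"
  proof (rule ccontr)
    assume "\<not> ?thesis"
    then have "\<kappa> ^ N \<le> \<kappa> ^ stop d \<omega>" using \<kappa> by (intro power_decreasing) auto
    also have "\<dots> \<le> len \<omega> (stop d \<omega>)" using \<kappa> valid by (intro power_le_len) auto
    finally show False using le d by simp
  qed
  have "d < 1" using d \<kappa> by (meson less_le_trans less_imp_le power_le_one)
  then have "stop d \<omega> \<noteq> 0" using le by (metis len_0 not_le)
  then obtain n where n: "stop d \<omega> = Suc n" using not0_implies_Suc by blast
  have "\<kappa> * d \<le> gls_q G (J n, \<omega> n) * len \<omega> n"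
    using gt[of n] n bspec[OF \<kappa>(1), of "(J n, \<omega> n)"] \<kappa>(2) d valid rows
    by (intro mult_mono) (auto simp del: gls_q.simps)
  then show "\<kappa> * d \<le> len \<omega> (stop d \<omega>)" using n by (simp add: len_Suc mult.commute)
qed

text \<open>
  The words obtained by stopping at scale \<open>d\<close> have cells with disjoint interiors and length between
  \<open>\<kappa> d\<close> and \<open>d\<close>. The left endpoints of those that meet \<open>U\<close> are therefore \<open>\<kappa> d\<close>-separated and lie within
  \<open>2 d\<close> of a given point of \<open>U\<close>, so there are at most \<open>4 / \<kappa> + 2\<close> of them. The condition \<open>d < \<kappa> ^ N\<close> makes
  the stopped words at least \<open>N\<close> long, so that each has probability at most \<open>d powr s\<close>. The sequences
  are covered by cylinders, which are measurable although \<open>A\<close> and \<open>U\<close> are arbitrary sets.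
\<close>
lemma cylinder_cover:
  fixes P :: "nat \<Rightarrow> nat pmf"
  assumes \<kappa>: "\<forall>e\<in>alphabet G. \<kappa> \<le> gls_q G e" "0 < \<kappa>" "\<kappa> < 1"
    and A: "\<And>\<omega>. \<omega> \<in> A \<Longrightarrow> digits \<omega>"
      "\<And>\<omega> n. \<omega> \<in> A \<Longrightarrow> N \<le> n \<Longrightarrow> (\<Prod>i<n. pmf (P i) (\<omega> i)) \<le> len \<omega> n powr s"
    and s: "0 \<le> s"
    and d: "0 < d" "d < \<kappa> ^ N" and U: "\<And>x y. x \<in> U \<Longrightarrow> y \<in> U \<Longrightarrow> \<bar>x - y\<bar> \<le> d"
  defines "M \<equiv> PiM UNIV (\<lambda>i. measure_pmf (P i))"
  shows "\<exists>E\<in>sets M. {\<omega>\<in>A. fibre_point \<omega> \<in> U} \<subseteq> E \<and> emeasure M E \<le> ennreal ((4 / \<kappa> + 2) * d powr s)"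
proof -
  interpret product_prob_space "\<lambda>i. measure_pmf (P i)" UNIV
    by unfold_locales
  define S where "S = {\<omega>\<in>A. fibre_point \<omega> \<in> U}"
  define word where "word \<omega> = map \<omega> [0..<stop d \<omega>]" for \<omega>
  define W where "W = word ` S"
  define cyl where "cyl w = {\<omega>\<in>space M. \<forall>i\<in>{..<length w}. \<omega> i \<in> {w ! i}}" for w
  define E where "E = (\<Union>w\<in>W. cyl w)"
  have cyl_sets: "cyl w \<in> sets M" for w
    unfolding cyl_def M_def
    by (intro sets.sets_Collect_finite_All sets_Collect_single') auto
  have cyl_measure: "emeasure M (cyl w) = ennreal (\<Prod>i<length w. pmf (P i) (w ! i))" for w
    unfolding cyl_def M_def
    by (subst emeasure_PiM_Collect) (auto simp: emeasure_pmf_single prod_ennreal)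
  show ?thesis
  proof (cases "S = {}")
    case True
    then show ?thesis by (intro bexI[of _ "{}"]) (auto simp: S_def)
  next
    case False
    then obtain \<omega>0 where \<omega>0: "\<omega>0 \<in> S" by blast
    define f where "f w = lo (\<lambda>i. w ! i) (length w)" for w
    have f_word: "f (word \<omega>) = lo \<omega> (stop d \<omega>)" for \<omega>
      unfolding f_def by (simp add: word_def, rule lo_cong) auto
    have dig: "digits \<omega>" if "\<omega> \<in> S" for \<omega> using that A by (simp add: S_def)
    note stop = stop_props[OF \<kappa> d]
    have sep: "\<kappa> * d \<le> \<bar>f w - f w'\<bar>" if W: "w \<in> W" "w' \<in> W" "w \<noteq> w'" for w w'
    proof -
      obtain \<omega> \<omega>' where \<omega>: "\<omega> \<in> S" "\<omega>' \<in> S" "w = word \<omega>" "w' = word \<omega>'"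
        using W by (auto simp: W_def)
      let ?n = "stop d \<omega>" and ?n' = "stop d \<omega>'"
      have "\<exists>m<min ?n ?n'. \<omega> m \<noteq> \<omega>' m"
      proof (rule ccontr)
        assume "\<not> ?thesis"
        then have eq: "\<omega> m = \<omega>' m" if "m < min ?n ?n'" for m using that by blast
        then have len_eq: "len \<omega> (min ?n ?n') = len \<omega>' (min ?n ?n')" by (intro len_cong) auto
        have "?n = ?n'"
        proof (cases rule: linorder_cases[of ?n ?n'])
          case less
          then show ?thesis
            using stop(1)[OF dig[OF \<omega>(1)]] stop(4)[OF dig[OF \<omega>(2)], of ?n] len_eq by simp
        next
          case greater
          then show ?thesis
            using stop(1)[OF dig[OF \<omega>(2)]] stop(4)[OF dig[OF \<omega>(1)], of ?n'] len_eq by (simp add: min_def)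
        qed
        then have "w = w'" using eq \<omega> by (simp add: word_def)
        with W show False by simp
      qed
      then obtain m' where m': "m' < min ?n ?n'" "\<omega> m' \<noteq> \<omega>' m'" by blast
      define m where "m = (LEAST m. \<omega> m \<noteq> \<omega>' m)"
      have m: "\<omega> m \<noteq> \<omega>' m" "m \<le> m'" "\<And>i. i < m \<Longrightarrow> \<omega> i = \<omega>' i"
        unfolding m_def using LeastI[of "\<lambda>m. \<omega> m \<noteq> \<omega>' m", OF m'(2)] m'(2)
        by (auto intro: Least_le dest: not_less_Least)
      have "min (len \<omega> ?n) (len \<omega>' ?n') \<le> \<bar>lo \<omega> ?n - lo \<omega>' ?n'\<bar>"
        using m m' dig \<omega> by (intro lo_separated[of \<omega> \<omega>' m]) auto
      then show ?thesis
        using stop(2)[OF dig[OF \<omega>(1)]] stop(2)[OF dig[OF \<omega>(2)]] \<omega> by (simp add: f_word)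
    qed
    have bd: "\<bar>f w - fibre_point \<omega>0\<bar> \<le> 2 * d" if wW: "w \<in> W" for w
    proof -
      obtain \<omega> where \<omega>: "\<omega> \<in> S" "w = word \<omega>" using wW by (auto simp: W_def)
      have "\<bar>fibre_point \<omega> - lo \<omega> (stop d \<omega>)\<bar> \<le> len \<omega> (stop d \<omega>)"
        using dig[OF \<omega>(1)] fibre_point_cell by (intro cell_lo) (auto simp: digits_def)
      moreover have "\<bar>fibre_point \<omega> - fibre_point \<omega>0\<bar> \<le> d"
        using U \<omega> \<omega>0 by (auto simp: S_def)
      ultimately show ?thesis using stop(1)[OF dig[OF \<omega>(1)]] \<omega> by (simp add: f_word)
    qed
    have pos: "0 < \<kappa> * d" using \<kappa> d by simp
    have W_ne: "W \<noteq> {}" using \<omega>0 by (auto simp: W_def)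
    have finW: "finite W" by (rule card_separated(1)[OF pos bd sep])
    have "real (card W) \<le> 2 * (2 * d) / (\<kappa> * d) + 2"
      by (rule card_separated(2)[OF pos bd sep W_ne])
    then have card_W: "real (card W) \<le> 4 / \<kappa> + 2" using d by simp
    have cyl_le: "emeasure M (cyl w) \<le> ennreal (d powr s)" if "w \<in> W" for w
    proof -
      obtain \<omega> where \<omega>: "\<omega> \<in> S" "w = word \<omega>" using \<open>w \<in> W\<close> by (auto simp: W_def)
      let ?n = "stop d \<omega>"
      have "(\<Prod>i<length w. pmf (P i) (w ! i)) = (\<Prod>i<?n. pmf (P i) (\<omega> i))"
        using \<omega> by (simp add: word_def)
      also have "\<dots> \<le> len \<omega> ?n powr s"
        using A(2)[of \<omega> ?n] \<omega> stop(3)[OF dig[OF \<omega>(1)]] by (auto simp: S_def)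
      also have "\<dots> \<le> d powr s"
        using stop(1)[OF dig[OF \<omega>(1)]] s len_pos[of ?n \<omega>] dig[OF \<omega>(1)]
        by (intro powr_mono2) (auto simp: digits_def less_imp_le)
      finally show ?thesis by (simp add: cyl_measure ennreal_leI)
    qed
    have "E \<in> sets M" unfolding E_def using finW cyl_sets by auto
    moreover have "S \<subseteq> E"
    proof
      fix \<omega> assume "\<omega> \<in> S"
      moreover have "\<omega> \<in> cyl (word \<omega>)" by (simp add: cyl_def word_def M_def space_PiM)
      ultimately show "\<omega> \<in> E" by (auto simp: E_def W_def)
    qed
    moreover have "emeasure M E \<le> ennreal ((4 / \<kappa> + 2) * d powr s)"
    proof -
      have "emeasure M E \<le> (\<Sum>w\<in>W. emeasure M (cyl w))"
        unfolding E_def using finW cyl_sets by (intro emeasure_subadditive_finite) auto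
      also have "\<dots> \<le> (\<Sum>w\<in>W. ennreal (d powr s))"
        by (intro sum_mono cyl_le)
      also have "\<dots> = ennreal (real (card W) * d powr s)"
        by (simp add: ennreal_mult ennreal_of_nat_eq_real_of_nat)
      also have "\<dots> \<le> ennreal ((4 / \<kappa> + 2) * d powr s)"
        using card_W by (intro ennreal_leI mult_right_mono) auto
      finally show ?thesis .
    qed
    ultimately show ?thesis unfolding S_def by blast
  qed
qed

text \<open>
  Covers of the image with small \<open>s\<close>-sums lift, by \<open>cylinder_cover\<close>, to measurable covers of \<open>A\<close> of small
  probability.
\<close>
lemma mass_distribution:
  fixes P :: "nat \<Rightarrow> nat pmf"
  assumes A: "\<And>\<omega>. \<omega> \<in> A \<Longrightarrow> digits \<omega>"
      "\<And>\<omega> n. \<omega> \<in> A \<Longrightarrow> N \<le> n \<Longrightarrow> (\<Prod>i<n. pmf (P i) (\<omega> i)) \<le> len \<omega> n powr s"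
    and s: "0 \<le> s" and null: "hausdorff_measure s (fibre_point ` A) = 0"
  shows "AE \<omega> in PiM UNIV (\<lambda>i. measure_pmf (P i)). \<omega> \<notin> A"
proof -
  interpret product_prob_space "\<lambda>i. measure_pmf (P i)" UNIV
    by unfold_locales
  define M where "M = PiM UNIV (\<lambda>i. measure_pmf (P i))"
  obtain \<kappa> where \<kappa>: "0 < \<kappa>" "\<kappa> < 1" "\<forall>e\<in>alphabet G. \<kappa> \<le> gls_q G e"
    using ratio_lower_bound by metis
  define C where "C = 4 / \<kappa> + 2"
  have C: "1 \<le> C" using \<kappa> by (simp add: C_def)
  define \<delta> where "\<delta> = \<kappa> ^ N / 2"
  have \<delta>: "0 < \<delta>" "\<delta> < \<kappa> ^ N" using \<kappa> by (auto simp: \<delta>_def)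
  have one: "\<exists>E\<in>sets M. {\<omega>\<in>A. fibre_point \<omega> \<in> U} \<subseteq> E \<and> emeasure M E \<le> ennreal C * diam_pow s U + ennreal \<eta>"
    if U: "bounded U" "diameter U \<le> \<delta>" and \<eta>: "0 < \<eta>" for U \<eta>
  proof -
    have cover: "\<exists>E\<in>sets M. {\<omega>\<in>A. fibre_point \<omega> \<in> U} \<subseteq> E \<and> emeasure M E \<le> ennreal (C * d powr s)"
      if "0 < d" "diameter U \<le> d" "d \<le> \<delta>" for d
      unfolding M_def C_def
    proof (rule cylinder_cover[OF \<kappa>(3,1,2) A s])
      show "0 < d" "d < \<kappa> ^ N" using that \<delta> by auto
      show "\<bar>x - y\<bar> \<le> d" if "x \<in> U" "y \<in> U" for x y
        using diameter_bounded_bound[OF U(1) that] \<open>diameter U \<le> d\<close> by (simp add: dist_real_def)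
    qed
    consider "U = {}" | "U \<noteq> {}" "s = 0" | "U \<noteq> {}" "0 < s" "0 < diameter U" | "0 < s" "diameter U = 0"
      using s diameter_ge_0[OF U(1)] by fastforce
    then show ?thesis
    proof cases
      case 1
      then show ?thesis by (intro bexI[of _ "{}"]) auto
    next
      case 2
      then obtain E where E: "E \<in> sets M" "{\<omega>\<in>A. fibre_point \<omega> \<in> U} \<subseteq> E" "emeasure M E \<le> ennreal C"
        using cover[of \<delta>] U \<delta> by auto
      have "ennreal C \<le> ennreal C * diam_pow s U + ennreal \<eta>"
        using 2 by (simp add: diam_pow_def)
      then show ?thesis using E by (meson order_trans)
    next
      case 3
      then have "ennreal C * diam_pow s U = ennreal (C * diameter U powr s)"
        using C by (simp add: diam_pow_def ennreal_mult)
      moreover obtain E where E: "E \<in> sets M" "{\<omega>\<in>A. fibre_point \<omega> \<in> U} \<subseteq> E"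
          "emeasure M E \<le> ennreal (C * diameter U powr s)"
        using cover[of "diameter U"] 3 U by auto
      ultimately have "emeasure M E \<le> ennreal C * diam_pow s U + ennreal \<eta>"
        by (simp add: add_increasing2)
      then show ?thesis using E by blast
    next
      case 4
      \<comment> \<open>A single point is covered at a scale so small that its contribution is absorbed by \<open>\<eta>\<close>.\<close>
      define d where "d = min \<delta> ((\<eta> / C) powr (1 / s))"
      have d: "0 < d" "d \<le> \<delta>" using \<delta> \<eta> C by (auto simp: d_def)
      have "d powr s \<le> ((\<eta> / C) powr (1 / s)) powr s"
        using d 4 by (intro powr_mono2) (auto simp: d_def)
      also have "\<dots> = \<eta> / C" using 4 \<eta> C by (simp add: powr_powr)
      finally have "C * d powr s \<le> \<eta>" using C by (simp add: field_simps)
      then have "ennreal (C * d powr s) \<le> ennreal C * diam_pow s U + ennreal \<eta>"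
        by (intro add_increasing ennreal_leI) auto
      moreover obtain E where E: "E \<in> sets M" "{\<omega>\<in>A. fibre_point \<omega> \<in> U} \<subseteq> E"
          "emeasure M E \<le> ennreal (C * d powr s)"
        using cover[OF d(1) _ d(2)] 4 d by auto
      ultimately show ?thesis by (meson order_trans)
    qed
  qed
  have small: "\<exists>E\<in>sets M. A \<subseteq> E \<and> emeasure M E \<le> ennreal \<epsilon>" if "0 < \<epsilon>" for \<epsilon>
  proof -
    have "0 < \<epsilon> / (2 * C)" using that C by simp
    from null[unfolded hausdorff_measure_eq_0_iff, THEN spec, THEN mp, OF \<delta>(1), THEN spec, THEN mp, OF this]
    obtain U where U: "fibre_point ` A \<subseteq> (\<Union>i. U i)"
      "\<forall>i :: nat. bounded (U i) \<and> diameter (U i) \<le> \<delta>"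
      "(\<Sum>i. diam_pow s (U i)) < ennreal (\<epsilon> / (2 * C))"
      by (elim exE conjE)
    have E_ex: "\<forall>i. \<exists>E. E \<in> sets M \<and> {\<omega>\<in>A. fibre_point \<omega> \<in> U i} \<subseteq> E \<and>
        emeasure M E \<le> ennreal C * diam_pow s (U i) + ennreal (\<epsilon> / 2 * (1 / 2) ^ Suc i)"
    proof
      fix i
      have "0 < \<epsilon> / 2 * (1 / 2) ^ Suc i" using that by simp
      from one[OF _ _ this, of "U i"] U(2)
      show "\<exists>E. E \<in> sets M \<and> {\<omega>\<in>A. fibre_point \<omega> \<in> U i} \<subseteq> E \<and>
        emeasure M E \<le> ennreal C * diam_pow s (U i) + ennreal (\<epsilon> / 2 * (1 / 2) ^ Suc i)"
        unfolding Bex_def by blast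
    qed
    obtain E where E_all: "\<And>i. E i \<in> sets M \<and> {\<omega>\<in>A. fibre_point \<omega> \<in> U i} \<subseteq> E i \<and>
        emeasure M (E i) \<le> ennreal C * diam_pow s (U i) + ennreal (\<epsilon> / 2 * (1 / 2) ^ Suc i)"
      using choice[OF E_ex] by blast
    have E: "E i \<in> sets M" "{\<omega>\<in>A. fibre_point \<omega> \<in> U i} \<subseteq> E i"
      "emeasure M (E i) \<le> ennreal C * diam_pow s (U i) + ennreal (\<epsilon> / 2 * (1 / 2) ^ Suc i)" for i
      using E_all[of i] by blast+
    have half: "(\<Sum>i. ennreal (\<epsilon> / 2 * (1 / 2) ^ Suc i)) = ennreal (\<epsilon> / 2)"
    proof (rule suminf_ennreal_eq)
      show "(\<lambda>i. \<epsilon> / 2 * (1 / 2) ^ Suc i) sums (\<epsilon> / 2)"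
        using sums_mult[OF power_half_series, of "\<epsilon> / 2"] by simp
    qed (use that in auto)
    have "emeasure M (\<Union>i. E i) \<le> (\<Sum>i. emeasure M (E i))"
      using E by (intro emeasure_subadditive_countably) auto
    also have "\<dots> \<le> (\<Sum>i. ennreal C * diam_pow s (U i) + ennreal (\<epsilon> / 2 * (1 / 2) ^ Suc i))"
      using E by (intro suminf_le) auto
    also have "\<dots> = ennreal C * (\<Sum>i. diam_pow s (U i)) + ennreal (\<epsilon> / 2)"
      by (simp only: suminf_add[symmetric] summableI ennreal_suminf_cmult half)
    also have "\<dots> \<le> ennreal C * ennreal (\<epsilon> / (2 * C)) + ennreal (\<epsilon> / 2)"
      using U(3) by (intro add_right_mono mult_left_mono) auto
    also have "\<dots> = ennreal (C * (\<epsilon> / (2 * C)) + \<epsilon> / 2)"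
    proof -
      have "0 \<le> C" "0 \<le> \<epsilon> / (2 * C)" "0 \<le> \<epsilon> / 2" using C that by auto
      then show ?thesis by (simp only: ennreal_mult ennreal_plus mult_nonneg_nonneg)
    qed
    also have "C * (\<epsilon> / (2 * C)) + \<epsilon> / 2 = \<epsilon>" using C by simp
    finally have "emeasure M (\<Union>i. E i) \<le> ennreal \<epsilon>" .
    moreover have "A \<subseteq> (\<Union>i. E i)" using U(1) E(2) by blast
    ultimately show ?thesis using E(1) by (intro bexI[of _ "\<Union>i. E i"]) auto
  qed
  have "\<forall>m. \<exists>E\<in>sets M. A \<subseteq> E \<and> emeasure M E \<le> ennreal (1 / Suc m)"
    using small by simp
  then obtain E where E: "\<And>m. E m \<in> sets M" "\<And>m. A \<subseteq> E m" "\<And>m. emeasure M (E m) \<le> ennreal (1 / Suc m)"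
    by metis
  have "emeasure M (\<Inter>m. E m) = 0"
  proof -
    have "emeasure M (\<Inter>m. E m) \<le> 0"
    proof (rule ennreal_le_epsilon)
      fix \<epsilon> :: real assume "0 < \<epsilon>"
      then obtain m where m: "1 / real (Suc m) < \<epsilon>" using nat_approx_posE by metis
      have "emeasure M (\<Inter>m. E m) \<le> emeasure M (E m)" using E(1) by (intro emeasure_mono) auto
      also have "\<dots> \<le> ennreal (1 / Suc m)" by (rule E(3))
      also have "\<dots> \<le> ennreal \<epsilon>" using m by (intro ennreal_leI) simp
      finally show "emeasure M (\<Inter>m. E m) \<le> 0 + ennreal \<epsilon>" by simp
    qed
    then show ?thesis by simp
  qed
  moreover have "(\<Inter>m. E m) \<in> sets M" using E(1) by auto
  ultimately show ?thesis
    unfolding M_def[symmetric] using E(2) by (intro AE_I[of _ _ "\<Inter>m. E m"]) auto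
qed

text \<open>
  The expected number of occurrences of \<open>(j, k)\<close> among the first \<open>n\<close> letters is \<open>b (j, k)\<close> times the number
  of occurrences of \<open>j\<close> in the row sequence; the strong law transfers its growth rate to almost every
  digit sequence.
\<close>
lemma AE_frequencies:
  fixes P :: "nat \<Rightarrow> nat pmf" and b :: "nat \<times> nat \<Rightarrow> real"
  assumes law: "\<And>i k. k < gls_B G (J i) \<Longrightarrow> pmf (P i) k = b (J i, k)"
      "\<And>i. set_pmf (P i) \<subseteq> {..<gls_B G (J i)}"
    and freq: "\<And>j. j < gls_J G \<Longrightarrow> has_frequency J j (a j)"
  shows "AE \<omega> in PiM UNIV (\<lambda>i. measure_pmf (P i)).
    digits \<omega> \<and> (\<forall>e\<in>alphabet G. has_frequency (\<lambda>i. (J i, \<omega> i)) e (a (fst e) * b e))"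
proof -
  interpret product_prob_space "\<lambda>i. measure_pmf (P i)" UNIV
    by unfold_locales
  define M where "M = PiM UNIV (\<lambda>i. measure_pmf (P i))"
  have "AE \<omega> in M. \<omega> i < gls_B G (J i)" for i
  proof -
    have "AE k in measure_pmf (P i). k < gls_B G (J i)"
      using law(2)[of i] by (auto simp: AE_measure_pmf_iff)
    then show ?thesis
      unfolding M_def by (rule AE_PiM_component[rotated 2]) (auto intro: measure_pmf.prob_space_axioms)
  qed
  then have "AE \<omega> in M. digits \<omega>"
    unfolding digits_def by (simp add: AE_all_countable)
  moreover have "AE \<omega> in M. has_frequency (\<lambda>i. (J i, \<omega> i)) e (a (fst e) * b e)" if e: "e \<in> alphabet G" for e
  proof -
    obtain j k where jk: "e = (j, k)" "j < gls_J G" "k < gls_B G j" using e by (cases e) auto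
    define X :: "nat \<Rightarrow> (nat \<Rightarrow> nat) \<Rightarrow> real" where "X i \<omega> = of_bool ((J i, \<omega> i) = e)" for i \<omega>
    have "P.indep_vars (\<lambda>_. borel) (\<lambda>i \<omega>. of_bool ((J i, \<omega> i) = e) :: real) UNIV"
      by (rule P.indep_vars_compose2[OF indep_vars_coordinates, of "\<lambda>i x. of_bool ((J i, x) = e)"]) auto
    then have indep: "P.indep_vars (\<lambda>_. borel) X UNIV"
      by (simp add: X_def[abs_def])
    have exp: "P.expectation (X i) = of_bool (J i = j) * b e" for i
    proof (cases "J i = j")
      case True
      have "P.expectation (X i) = P.expectation (indicator {x \<in> space M. x i \<in> {k}})"
        using True jk by (intro Bochner_Integration.integral_cong)
          (auto simp: X_def M_def indicator_def of_bool_def)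
      also have "\<dots> = measure M {x \<in> space M. x i \<in> {k}}"
        unfolding M_def Bochner_Integration.integral_indicator by (intro arg_cong[where f = prob]) auto
      also have "\<dots> = pmf (P i) k"
        unfolding measure_def M_def by (subst emeasure_PiM_Collect_single) (auto simp: emeasure_pmf_single)
      finally show ?thesis using law(1)[of k i] True jk by simp
    qed (use jk in \<open>simp add: X_def[abs_def]\<close>)
    have J_freq: "(\<lambda>n. (\<Sum>i<n. of_bool (J i = j)) / real n) \<longlonglongrightarrow> a j"
      using freq[OF jk(2)] by (simp add: has_frequency_of_bool)
    have "AE \<omega> in M. (\<lambda>n. ((\<Sum>i<n. X i \<omega>) - (\<Sum>i<n. P.expectation (X i))) / real n) \<longlonglongrightarrow> 0"
      unfolding M_def by (rule P.strong_law_bounded[OF indep]) (simp add: X_def)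
    then show ?thesis
    proof (rule AE_mp, intro AE_I2 impI)
      fix \<omega>
      assume "(\<lambda>n. ((\<Sum>i<n. X i \<omega>) - (\<Sum>i<n. P.expectation (X i))) / real n) \<longlonglongrightarrow> 0"
      from tendsto_add[OF this tendsto_mult_right[OF J_freq, of "b e"]]
      have "(\<lambda>n. (\<Sum>i<n. X i \<omega>) / real n) \<longlonglongrightarrow> a j * b e"
        by (simp add: exp diff_divide_distrib sum_distrib_right[symmetric] mult.commute)
      then show "has_frequency (\<lambda>i. (J i, \<omega> i)) e (a (fst e) * b e)"
        using jk by (simp add: has_frequency_of_bool X_def)
    qed
  qed
  then have "AE \<omega> in M. \<forall>e\<in>alphabet G. has_frequency (\<lambda>i. (J i, \<omega> i)) e (a (fst e) * b e)"
    by (intro AE_finite_allI finite_alphabet)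
  ultimately show ?thesis unfolding M_def by eventually_elim simp
qed

end

section \<open>The two dimension bounds\<close>

locale gls_frequency = gls_system +
  fixes \<alpha> :: "nat \<times> nat \<Rightarrow> real"
  assumes freq: "frequency_vector G \<alpha>"
    and row_pos: "\<forall>j<gls_J G. 0 < row_frequency G \<alpha> j"
begin

definition cond :: "nat \<times> nat \<Rightarrow> real" where
  "cond e = \<alpha> e / row_frequency G \<alpha> (fst e)"

text \<open>
  This is minus the conditional entropy of the letter given its row (see \<open>entropy_cond\<close>); like
  \<open>lyapunov\<close> it carries the sign it has in the claimed quotient, where both are at most \<open>0\<close>.
\<close>
definition entropy :: real where
  "entropy = (\<Sum>e\<in>alphabet G. \<alpha> e * ln (\<alpha> e)) - (\<Sum>j<gls_J G. row_frequency G \<alpha> j * ln (row_frequency G \<alpha> j))"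

definition lyapunov :: real where
  "lyapunov = (\<Sum>e\<in>alphabet G. \<alpha> e * ln (gls_q G e))"

lemma alpha_nonneg: "e \<in> alphabet G \<Longrightarrow> 0 \<le> \<alpha> e"
  and alpha_sum: "(\<Sum>e\<in>alphabet G. \<alpha> e) = 1"
  using freq by (auto simp: frequency_vector_def)

lemma cond_nonneg: "e \<in> alphabet G \<Longrightarrow> 0 \<le> cond e"
  using alpha_nonneg row_pos by (cases e) (auto simp: cond_def less_imp_le)

lemma cond_sum: "j < gls_J G \<Longrightarrow> (\<Sum>k<gls_B G j. cond (j, k)) = 1"
  using row_pos by (auto simp: cond_def row_frequency_def[of G \<alpha> j] simp flip: sum_divide_distrib)

lemma cond_le_1:
  assumes "e \<in> alphabet G" shows "cond e \<le> 1"
proof -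
  obtain j k where e: "e = (j, k)" "j < gls_J G" "k < gls_B G j" using assms by (cases e) auto
  have "cond (j, k) \<le> (\<Sum>k<gls_B G j. cond (j, k))"
    using e cond_nonneg by (intro member_le_sum) auto
  then show ?thesis using e cond_sum by simp
qed

lemma entropy_cond: "entropy = (\<Sum>e\<in>alphabet G. \<alpha> e * ln (cond e))"
proof -
  have "(\<Sum>j<gls_J G. row_frequency G \<alpha> j * ln (row_frequency G \<alpha> j)) =
      (\<Sum>e\<in>alphabet G. \<alpha> e * ln (row_frequency G \<alpha> (fst e)))"
    unfolding sum_alphabet by (simp add: row_frequency_def sum_distrib_right)
  moreover have "\<alpha> e * ln (cond e) = \<alpha> e * ln (\<alpha> e) - \<alpha> e * ln (row_frequency G \<alpha> (fst e))"
    if "e \<in> alphabet G" for e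
  proof (cases "\<alpha> e = 0")
    case False
    then have "0 < \<alpha> e" "0 < row_frequency G \<alpha> (fst e)"
      using alpha_nonneg[OF that] row_pos that by (auto simp: alphabet_def)
    then show ?thesis by (simp add: cond_def ln_div algebra_simps)
  qed simp
  ultimately show ?thesis by (simp add: entropy_def sum_subtractf)
qed

lemma entropy_nonpos: "entropy \<le> 0"
  unfolding entropy_cond
proof (intro sum_nonpos mult_nonneg_nonpos)
  fix e assume e: "e \<in> alphabet G"
  show "0 \<le> \<alpha> e" using alpha_nonneg e .
  show "ln (cond e) \<le> 0"
    using cond_nonneg[OF e] cond_le_1[OF e] by (cases "cond e = 0") auto
qed

lemma lyapunov_neg: "lyapunov < 0"
proof -
  have "\<exists>e\<in>alphabet G. \<alpha> e \<noteq> 0"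
    using alpha_sum by (metis sum.neutral zero_neq_one)
  then obtain e where e: "e \<in> alphabet G" "0 < \<alpha> e" using alpha_nonneg by fastforce
  have ln_q: "ln (gls_q G e) < 0" if "e \<in> alphabet G" for e
    using q_pos[OF that] q_less_1[OF that] by (rule ln_less_zero)
  have "0 < (\<Sum>e\<in>alphabet G. \<alpha> e * - ln (gls_q G e))"
  proof (rule sum_pos2[OF finite_alphabet e(1)])
    show "0 < \<alpha> e * - ln (gls_q G e)" using e ln_q by (intro mult_pos_pos) auto
    show "0 \<le> \<alpha> e * - ln (gls_q G e)" if "e \<in> alphabet G" for e
      using alpha_nonneg[OF that] ln_q[OF that] by (intro mult_nonneg_nonneg) auto
  qed
  then show ?thesis by (simp add: lyapunov_def sum_negf)
qed

end

lemma (in gls_fibre) len_powr: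
  assumes "digits \<omega>"
  shows "len \<omega> n powr s = exp (\<Sum>i<n. s * ln (gls_q G (J i, \<omega> i)))"
proof -
  have q: "0 < gls_q G (J i, \<omega> i)" for i
    using assms rows by (intro q_pos) (auto simp: digits_def)
  have q_neq: "gls_q G (J i, \<omega> i) \<noteq> 0" for i using q[of i] by linarith
  have "0 < len \<omega> n" unfolding len_def using q by (intro prod_pos) auto
  moreover have "ln (len \<omega> n) = (\<Sum>i<n. ln (gls_q G (J i, \<omega> i)))"
    unfolding len_def using q q_neq by (intro ln_prod) (auto simp del: gls_q.simps)
  ultimately show ?thesis by (simp add: powr_def sum_distrib_left)
qed

text \<open>
  If some factor is \<open>0\<close>, the left side vanishes; since \<open>ln 0 = 0\<close>, the right side simply omits that
  factor, and the inequality can be strict. This covers letters of frequency \<open>0\<close>.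
\<close>
lemma prod_le_exp_sum_ln:
  assumes "\<And>i. i \<in> A \<Longrightarrow> (0::real) \<le> f i"
  shows "(\<Prod>i\<in>A. f i) \<le> exp (\<Sum>i\<in>A. ln (f i))"
proof (cases "finite A")
  case True
  have "f i \<le> exp (ln (f i))" if "i \<in> A" for i
    using assms[OF that] by (cases "f i = 0") auto
  then show ?thesis
    unfolding exp_sum[OF True] using assms by (intro prod_mono) auto
qed simp

context gls_frequency
begin

text \<open>
  The weight is \<open>cond\<close> mixed with the uniform law on each row. The mixture is positive also on letters
  of frequency \<open>0\<close>, which may occur in a code without affecting its frequencies, and it lowers the
  exponent \<open>entropy\<close> by at most \<open>- ln (1 - \<eta>)\<close>.
\<close>
theorem hausdorff_dim_level_set_le:
  assumes y: "y \<in> level_heights G \<alpha>"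
  shows "hausdorff_dim (level_set G \<alpha> y) \<le> ereal (entropy / lyapunov)"
proof (rule ereal_le_epsilon2)
  fix \<epsilon> :: real assume "0 < \<epsilon>"
  define s where "s = entropy / lyapunov + \<epsilon>"
  have ratio: "0 \<le> entropy / lyapunov"
    using entropy_nonpos lyapunov_neg by (simp add: divide_nonpos_neg)
  then have s: "0 < s" using \<open>0 < \<epsilon>\<close> by (simp add: s_def)
  define g where "g = entropy - s * lyapunov"
  have g: "0 < g"
    using lyapunov_neg \<open>0 < \<epsilon>\<close> by (simp add: g_def s_def distrib_right mult_pos_neg)
  \<comment> \<open>Half of the gap \<open>g\<close> pays for the mixing; what is left exceeds \<open>g / 4\<close>, the rate of decay.\<close>
  define \<eta> where "\<eta> = 1 - exp (- g / 2)"
  have \<eta>: "0 < \<eta>" "\<eta> < 1" "ln (1 - \<eta>) = - g / 2" using g by (auto simp: \<eta>_def)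
  define b where "b e = (1 - \<eta>) * cond e + \<eta> / real (gls_B G (fst e))" for e
  have B: "0 < gls_B G j" if "j < gls_J G" for j using two_digits[OF that] by simp
  have b_pos: "0 < b e" if "e \<in> alphabet G" for e
    unfolding b_def using cond_nonneg[OF that] \<eta> B that
    by (intro add_nonneg_pos) (auto simp: alphabet_def)
  have b_sum: "(\<Sum>k<gls_B G j. b (j, k)) = 1" if "j < gls_J G" for j
    unfolding b_def using cond_sum[OF that] B[OF that]
    by (simp add: sum.distrib flip: sum_distrib_left)
  have avg: "g / 2 \<le> (\<Sum>e\<in>alphabet G. \<alpha> e * (ln (b e) - s * ln (gls_q G e)))"
  proof -
    have "\<alpha> e * (ln (1 - \<eta>) + ln (cond e)) \<le> \<alpha> e * ln (b e)" if e: "e \<in> alphabet G" for e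
    proof (cases "\<alpha> e = 0")
      case False
      then have pos: "0 < cond e" "0 < \<alpha> e"
        using alpha_nonneg[OF e] row_pos e by (auto simp: alphabet_def cond_def)
      then have "ln (1 - \<eta>) + ln (cond e) = ln ((1 - \<eta>) * cond e)"
        using \<eta> by (simp add: ln_mult)
      also have "\<dots> \<le> ln (b e)"
        using \<eta> pos by (intro ln_mono) (auto simp: b_def)
      finally show ?thesis using pos by simp
    qed simp
    then have "(\<Sum>e\<in>alphabet G. \<alpha> e * (ln (1 - \<eta>) + ln (cond e))) \<le> (\<Sum>e\<in>alphabet G. \<alpha> e * ln (b e))"
      by (rule sum_mono)
    also have "(\<Sum>e\<in>alphabet G. \<alpha> e * (ln (1 - \<eta>) + ln (cond e))) =
        (\<Sum>e\<in>alphabet G. \<alpha> e) * ln (1 - \<eta>) + entropy"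
      by (simp add: distrib_left sum.distrib entropy_cond sum_distrib_right)
    also have "\<dots> = - g / 2 + entropy" using alpha_sum \<eta> by simp
    finally have "- g / 2 + entropy \<le> (\<Sum>e\<in>alphabet G. \<alpha> e * ln (b e))" .
    moreover have "(\<Sum>e\<in>alphabet G. \<alpha> e * (ln (b e) - s * ln (gls_q G e))) =
        (\<Sum>e\<in>alphabet G. \<alpha> e * ln (b e)) - s * lyapunov"
      by (simp add: right_diff_distrib sum_subtractf lyapunov_def sum_distrib_left mult.left_commute)
    ultimately show ?thesis using g_def by linarith
  qed
  obtain x0 where "x0 \<in> level_set G \<alpha> y" using y by (auto simp: level_heights_def)
  then obtain \<omega>0 where \<omega>0: "\<omega>0 \<in> sequences G" "y = row_point (\<lambda>i. fst (\<omega>0 i))"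
      "\<forall>e\<in>alphabet G. has_frequency \<omega>0 e (\<alpha> e)"
    unfolding level_set_code by blast
  define J where "J i = fst (\<omega>0 i)" for i
  have fst_less: "fst (\<omega> i) < gls_J G" if "\<omega> \<in> sequences G" for \<omega> i
    by (rule sequence_row[OF that])
  interpret gls_fibre G J
    by unfold_locales (simp add: J_def fst_less \<omega>0)
  have "hausdorff_measure s (level_set G \<alpha> y) = 0"
  proof (rule hausdorff_measure_0_of_weights[of b s "g / 4"])
    show "0 \<le> b e" if "e \<in> alphabet G" for e using b_pos[OF that] by simp
    show "(\<Sum>k<gls_B G j. b (j, k)) = 1" if "j < gls_J G" for j using b_sum that .
    show "0 < s" "0 < g / 4" using s g by auto
    fix x assume "x \<in> level_set G \<alpha> y"
    then obtain \<omega> where \<omega>: "\<omega> \<in> sequences G" "y = row_point (\<lambda>i. fst (\<omega> i))"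
        "x = affine_point (\<lambda>i. hor_a G (\<omega> i)) (\<lambda>i. hor_v G (\<omega> i))"
        "\<forall>e\<in>alphabet G. has_frequency \<omega> e (\<alpha> e)"
      unfolding level_set_code by blast
    have one: "1 < gls_J G" using two_rows by simp
    have "(\<lambda>i. fst (\<omega> i)) = (\<lambda>i. fst (\<omega>0 i))"
    proof (rule row_sequence_unique)
      show "has_frequency (\<lambda>i. fst (\<omega> i)) 1 (row_frequency G \<alpha> 1)"
           "has_frequency (\<lambda>i. fst (\<omega>0 i)) 1 (row_frequency G \<alpha> 1)"
        using row_has_frequency \<omega> \<omega>0 one by auto
      show "0 < row_frequency G \<alpha> 1" using row_pos one by blast
    qed (use \<omega> \<omega>0 fst_less in auto)
    then have J: "fst (\<omega> i) = J i" for i unfolding J_def by meson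
    define \<xi> where "\<xi> i = snd (\<omega> i)" for i
    have \<omega>_eq: "\<omega> i = (J i, \<xi> i)" for i
      using J by (simp add: \<xi>_def prod_eq_iff)
    have al: "(J i, \<xi> i) \<in> alphabet G" for i
      using \<omega>(1) \<omega>_eq by (simp add: sequences_def)
    have dig: "digits \<xi>" using al by (simp add: digits_def)
    have x: "x = fibre_point \<xi>" by (simp add: \<omega>(3) fibre_point_def \<omega>_eq)
    have "(\<lambda>n. (\<Sum>i<n. ln (b (\<omega> i)) - s * ln (gls_q G (\<omega> i))) / real n) \<longlonglongrightarrow>
        (\<Sum>e\<in>alphabet G. \<alpha> e * (ln (b e) - s * ln (gls_q G e)))"
      using \<omega> by (intro frequency_average finite_alphabet) (auto simp: sequences_def)
    moreover have "g / 4 < (\<Sum>e\<in>alphabet G. \<alpha> e * (ln (b e) - s * ln (gls_q G e)))"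
      using avg g by simp
    ultimately have "\<forall>\<^sub>F n in sequentially. g / 4 < (\<Sum>i<n. ln (b (\<omega> i)) - s * ln (gls_q G (\<omega> i))) / real n"
      by (rule order_tendstoD)
    then have "\<forall>\<^sub>F n in sequentially. len \<xi> n powr s \<le> exp (- (g / 4)) ^ n * (\<Prod>i<n. b (J i, \<xi> i))"
      using eventually_gt_at_top[of 0]
    proof eventually_elim
      case (elim n)
      then have "(\<Sum>i<n. s * ln (gls_q G (\<omega> i))) \<le> real n * - (g / 4) + (\<Sum>i<n. ln (b (\<omega> i)))"
        by (simp add: pos_less_divide_eq sum_subtractf mult.commute)
      then have "exp (\<Sum>i<n. s * ln (gls_q G (\<omega> i))) \<le> exp (real n * - (g / 4)) * exp (\<Sum>i<n. ln (b (\<omega> i)))"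
        by (simp flip: exp_add)
      moreover have "exp (\<Sum>i<n. ln (b (\<omega> i))) = (\<Prod>i<n. b (J i, \<xi> i))"
        using b_pos al by (simp add: exp_sum \<omega>_eq)
      ultimately show ?case
        unfolding len_powr[OF dig] by (simp only: exp_of_nat_mult \<omega>_eq)
    qed
    then show "\<exists>\<omega>. digits \<omega> \<and> x = fibre_point \<omega> \<and>
        (\<forall>\<^sub>F n in sequentially. len \<omega> n powr s \<le> exp (- (g / 4)) ^ n * (\<Prod>i<n. b (J i, \<omega> i)))"
      using dig x by blast
  qed
  then have "hausdorff_dim (level_set G \<alpha> y) \<le> ereal s"
    unfolding hausdorff_dim_def using s by (intro Inf_lower) auto
  then show "hausdorff_dim (level_set G \<alpha> y) \<le> ereal (entropy / lyapunov) + ereal \<epsilon>"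
    by (simp add: s_def)
qed

text \<open>
  If \<open>s\<close> were below the ratio, the set \<open>A N\<close> of good digit sequences whose weights are dominated by
  \<open>len powr s\<close> from time \<open>N\<close> on would be null for every \<open>N\<close>, yet almost every sequence lies in one of them.
\<close>
theorem hausdorff_dim_level_set_ge:
  assumes y: "y \<in> level_heights G \<alpha>"
  shows "ereal (entropy / lyapunov) \<le> hausdorff_dim (level_set G \<alpha> y)"
  unfolding hausdorff_dim_def
proof (rule Inf_greatest, clarify)
  fix s :: real assume s: "0 \<le> s" "hausdorff_measure s (level_set G \<alpha> y) = 0"
  have "entropy / lyapunov \<le> s"
  proof (rule ccontr)
    assume "\<not> ?thesis"
    then have drift: "entropy - s * lyapunov < 0"
      using lyapunov_neg by (simp add: not_le neg_less_divide_eq)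
    obtain x0 where "x0 \<in> level_set G \<alpha> y" using y by (auto simp: level_heights_def)
    then obtain \<omega>0 where \<omega>0: "\<omega>0 \<in> sequences G" "y = row_point (\<lambda>i. fst (\<omega>0 i))"
        "\<forall>e\<in>alphabet G. has_frequency \<omega>0 e (\<alpha> e)"
      unfolding level_set_code by blast
    define J where "J i = fst (\<omega>0 i)" for i
    have J_less: "J i < gls_J G" for i
      unfolding J_def by (rule sequence_row[OF \<omega>0(1)])
    have J_freq: "has_frequency J j (row_frequency G \<alpha> j)" if "j < gls_J G" for j
      using row_has_frequency[OF \<omega>0(1,3) that] by (simp add: J_def[abs_def])
    interpret gls_fibre G J
      by unfold_locales (rule J_less)
    define P where "P i = embed_pmf (\<lambda>k. if k < gls_B G (J i) then cond (J i, k) else 0)" for i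
    have pmf_P: "pmf (P i) k = (if k < gls_B G (J i) then cond (J i, k) else 0)" for i k
      unfolding P_def
    proof (rule pmf_embed_pmf)
      show "0 \<le> (if k < gls_B G (J i) then cond (J i, k) else 0)" for k
        using cond_nonneg[of "(J i, k)"] J_less by simp
      have "(\<integral>\<^sup>+ k. ennreal (if k < gls_B G (J i) then cond (J i, k) else 0) \<partial>count_space UNIV) =
          (\<Sum>k<gls_B G (J i). ennreal (cond (J i, k)))"
        by (subst nn_integral_count_space'[of "{..<gls_B G (J i)}"]) auto
      also have "\<dots> = ennreal (\<Sum>k<gls_B G (J i). cond (J i, k))"
        using cond_nonneg J_less by (intro sum_ennreal) auto
      finally show "(\<integral>\<^sup>+ k. ennreal (if k < gls_B G (J i) then cond (J i, k) else 0) \<partial>count_space UNIV) = 1"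
        using cond_sum[OF J_less] by simp
    qed
    let ?M = "PiM UNIV (\<lambda>i. measure_pmf (P i))"
    define good where "good = {\<omega>. digits \<omega> \<and> (\<forall>e\<in>alphabet G. has_frequency (\<lambda>i. (J i, \<omega> i)) e (\<alpha> e))}"
    have "AE \<omega> in ?M. digits \<omega> \<and> (\<forall>e\<in>alphabet G. has_frequency (\<lambda>i. (J i, \<omega> i)) e
        (row_frequency G \<alpha> (fst e) * cond e))"
      by (rule AE_frequencies) (auto simp: pmf_P set_pmf_eq J_freq split: if_splits)
    moreover have "row_frequency G \<alpha> (fst e) * cond e = \<alpha> e" if "e \<in> alphabet G" for e
      using row_pos that by (auto simp: cond_def alphabet_def)
    ultimately have AE_good: "AE \<omega> in ?M. \<omega> \<in> good" by (simp add: good_def)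
    define A where "A N = {\<omega> \<in> good. \<forall>n\<ge>N. (\<Prod>i<n. pmf (P i) (\<omega> i)) \<le> len \<omega> n powr s}" for N
    have good_A: "\<exists>N. \<omega> \<in> A N" if "\<omega> \<in> good" for \<omega>
    proof -
      have dig: "digits \<omega>" using that by (simp add: good_def)
      then have al: "(J i, \<omega> i) \<in> alphabet G" for i using J_less by (simp add: digits_def)
      have "(\<lambda>n. (\<Sum>i<n. ln (cond (J i, \<omega> i)) - s * ln (gls_q G (J i, \<omega> i))) / real n) \<longlonglongrightarrow>
          (\<Sum>e\<in>alphabet G. \<alpha> e * (ln (cond e) - s * ln (gls_q G e)))"
        by (rule frequency_average) (use al that finite_alphabet in \<open>auto simp: good_def simp del: gls_q.simps in_alphabet\<close>)
      moreover have "(\<Sum>e\<in>alphabet G. \<alpha> e * (ln (cond e) - s * ln (gls_q G e))) < 0"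
        using drift
        by (simp add: right_diff_distrib sum_subtractf lyapunov_def entropy_cond sum_distrib_left mult.left_commute)
      ultimately have "\<forall>\<^sub>F n in sequentially.
          (\<Sum>i<n. ln (cond (J i, \<omega> i)) - s * ln (gls_q G (J i, \<omega> i))) / real n < 0"
        by (rule order_tendstoD)
      then have "\<forall>\<^sub>F n in sequentially. (\<Prod>i<n. pmf (P i) (\<omega> i)) \<le> len \<omega> n powr s"
        using eventually_gt_at_top[of 0]
      proof eventually_elim
        case (elim n)
        then have "(\<Sum>i<n. ln (cond (J i, \<omega> i))) \<le> (\<Sum>i<n. s * ln (gls_q G (J i, \<omega> i)))"
          by (simp add: divide_less_0_iff sum_subtractf del: gls_q.simps)
        moreover have "(\<Prod>i<n. pmf (P i) (\<omega> i)) = (\<Prod>i<n. cond (J i, \<omega> i))"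
          using dig by (simp add: pmf_P digits_def)
        moreover have "(\<Prod>i<n. cond (J i, \<omega> i)) \<le> exp (\<Sum>i<n. ln (cond (J i, \<omega> i)))"
          using cond_nonneg al by (intro prod_le_exp_sum_ln) blast
        ultimately show ?case
          unfolding len_powr[OF dig] using order_trans by fastforce
      qed
      then show ?thesis using that unfolding A_def eventually_sequentially by blast
    qed
    have "AE \<omega> in ?M. \<forall>N. \<omega> \<notin> A N"
      unfolding AE_all_countable
    proof
      fix N
      have "fibre_point ` A N \<subseteq> level_set G \<alpha> y"
      proof
        fix x assume "x \<in> fibre_point ` A N"
        then obtain \<omega> where \<omega>: "\<omega> \<in> good" "x = fibre_point \<omega>" by (auto simp: A_def)
        then have "(\<lambda>i. (J i, \<omega> i)) \<in> sequences G"
          using J_less by (simp add: good_def digits_def sequences_def)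
        then show "x \<in> level_set G \<alpha> y"
          unfolding level_set_code using \<omega> \<omega>0(2)
          by (intro bexI[of _ "\<lambda>i. (J i, \<omega> i)"]) (auto simp: fibre_point_def good_def J_def)
      qed
      then have "hausdorff_measure s (fibre_point ` A N) = 0"
        using s(2) unfolding hausdorff_measure_eq_0_iff by (meson order_trans)
      then show "AE \<omega> in ?M. \<omega> \<notin> A N"
        using s(1) by (intro mass_distribution) (auto simp: A_def good_def)
    qed
    then have "AE \<omega> in ?M. False"
      using AE_good by eventually_elim (use good_A in blast)
    moreover have "prob_space ?M"
      by (intro prob_space_PiM measure_pmf.prob_space_axioms)
    ultimately show False
      using prob_space.AE_False by blast
  qed
  then show "ereal (entropy / lyapunov) \<le> ereal s" by simp
qed

end

theorem theorem1p2:
  fixes G :: gls and \<alpha> :: "nat \<times> nat \<Rightarrow> real"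
  assumes "gls_ifs G"
    and "frequency_vector G \<alpha>"
    and "\<forall>j<gls_J G. 0 < row_frequency G \<alpha> j"
  shows "(\<forall>y\<in>level_heights G \<alpha>.
            hausdorff_dim (level_set G \<alpha> y) \<le>
              ereal (((\<Sum>e\<in>alphabet G. \<alpha> e * ln (\<alpha> e))
                       - (\<Sum>j<gls_J G. row_frequency G \<alpha> j * ln (row_frequency G \<alpha> j)))
                     / (\<Sum>e\<in>alphabet G. \<alpha> e * ln (gls_q G e))))
       \<and> ((\<forall>j<gls_J G. \<exists>k<gls_B G j. \<exists>l<gls_B G j.
              k \<noteq> l \<and> 0 < \<alpha> (j, k) \<and> 0 < \<alpha> (j, l)) \<longrightarrow>
          (AE y in gls_nu G \<alpha>. y \<in> level_heights G \<alpha> \<longrightarrow>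
            ereal (((\<Sum>e\<in>alphabet G. \<alpha> e * ln (\<alpha> e))
                     - (\<Sum>j<gls_J G. row_frequency G \<alpha> j * ln (row_frequency G \<alpha> j)))
                   / (\<Sum>e\<in>alphabet G. \<alpha> e * ln (gls_q G e)))
              \<le> hausdorff_dim (level_set G \<alpha> y)))"
proof -
  interpret gls_frequency G \<alpha>
    using assms by unfold_locales
  note bounds = hausdorff_dim_level_set_le[unfolded entropy_def lyapunov_def]
    hausdorff_dim_level_set_ge[unfolded entropy_def lyapunov_def]
  show ?thesis
    using bounds by (intro conjI ballI impI AE_I2) auto
qed

end
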